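(* For every $\rho \in \mathcal{S}$, $\sigma \in \mathcal{P}$ and $\alpha\in(0,1)\cup(1,\infty)$, $D_{\alpha}^{\mathbb{P}}(\rho\|\sigma) = D_{\alpha}^{\mathbb{M}}(\rho\|\sigma)$.
   Context: Work on a $d$-dimensional complex Hilbert space; $\mathcal{P}$ denotes positive semidefinite operators, $\mathcal{S}$ density operators, $\log$ the natural logarithm. For a probability measure $P$ and positive measure $Q$ on a finite set $\mathcal{X}$ and $\alpha\in(0,1)\cup(1,\infty)$, the Rényi divergence is $D_\alpha(P\|Q)=\frac{1}{\alpha-1}\log\sum_x P(x)^\alpha Q(x)^{1-\alpha}$ (for $\alpha>1$ it is $+\infty$ unless $P\ll Q$, with terms $P(x)=0$ contributing $0$; for $\alpha<1$ it is $+\infty$ when the sum is $0$). A POVM $M$ on a finite set $\mathcal{X}$ maps $\mathcal{X}$ to positive semidefinite operators summing to the identity, inducing $P_{\rho,M}(x)=\operatorname{tr}[M(x)\rho]$. The measured Rényi relative entropy is $D^{\mathbb{M}}_\alpha(\rho\|\sigma):=\sup_{(\mathcal{X},M)}D_\alpha(P_{\rho,M}\|P_{\sigma,M})$ over all finite sets and POVMs. The projectively measured Rényi relative entropy is $D^{\mathbb{P}}_\alpha(\rho\|\sigma)=\frac{1}{\alpha-1}\log Q^{\mathbb{P}}_\alpha(\rho\|\sigma)$ where $Q^{\mathbb{P}}_\alpha(\rho\|\sigma)$ is $\sup$ (for $\alpha>1$) resp. $\min$ (for $\alpha\in(0,1)$) over families $\{P_i\}_{i=1}^d$ of mutually orthogonal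 rank-one projectors of $\sum_i \operatorname{tr}[P_i\rho]^\alpha\operatorname{tr}[P_i\sigma]^{1-\alpha}$ (with the same conventions for zeros). *)

theory Defs
  imports "HOL-Analysis.Analysis"
begin

text \<open>Operators on the d-dimensional complex Hilbert space C^d, where d = CARD('n),
  represented as matrices of type complex^'n^'n.\<close>

definition qform :: "complex^'n^'n \<Rightarrow> complex^'n \<Rightarrow> complex" where
  "qform A v = (\<Sum>i\<in>UNIV. cnj (v $ i) * (A *v v) $ i)"

definition psd :: "complex^'n^'n \<Rightarrow> bool" where
  "psd A \<longleftrightarrow> (\<forall>v. Im (qform A v) = 0 \<and> 0 \<le> Re (qform A v))"

definition mtrace :: "complex^'n^'n \<Rightarrow> complex" where
  "mtrace A = (\<Sum>i\<in>UNIV. A $ i $ i)"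

definition density_op :: "complex^'n^'n \<Rightarrow> bool" where
  "density_op \<rho> \<longleftrightarrow> psd \<rho> \<and> mtrace \<rho> = 1"

definition povm :: "'x set \<Rightarrow> ('x \<Rightarrow> complex^'n^'n) \<Rightarrow> bool" where
  "povm X M \<longleftrightarrow> finite X \<and> (\<forall>x\<in>X. psd (M x)) \<and> (\<Sum>x\<in>X. M x) = mat 1"

text \<open>Induced distribution P_{rho,M}(x) = tr[M(x) rho] (real for psd arguments).\<close>
definition meas_prob :: "complex^'n^'n \<Rightarrow> ('x \<Rightarrow> complex^'n^'n) \<Rightarrow> 'x \<Rightarrow> real" where
  "meas_prob \<rho> M x = Re (mtrace (M x ** \<rho>))"

definition renyi_Q :: "real \<Rightarrow> 'x set \<Rightarrow> ('x \<Rightarrow> real) \<Rightarrow> ('x \<Rightarrow> real) \<Rightarrow> ereal" where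
  "renyi_Q \<alpha> X P Q =
     (if \<alpha> > 1 \<and> (\<exists>x\<in>X. P x > 0 \<and> Q x = 0) then \<infinity>
      else ereal (\<Sum>x\<in>X. if P x = 0 then 0 else P x powr \<alpha> * Q x powr (1 - \<alpha>)))"

definition D_of_Q :: "real \<Rightarrow> ereal \<Rightarrow> ereal" where
  "D_of_Q \<alpha> q =
     (if q = \<infinity> then \<infinity>
      else if \<alpha> < 1 \<and> q = 0 then \<infinity>
      else ereal (ln (real_of_ereal q) / (\<alpha> - 1)))"

definition renyi_div :: "real \<Rightarrow> 'x set \<Rightarrow> ('x \<Rightarrow> real) \<Rightarrow> ('x \<Rightarrow> real) \<Rightarrow> ereal" where
  "renyi_div \<alpha> X P Q = D_of_Q \<alpha> (renyi_Q \<alpha> X P Q)"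

text \<open>Measured Renyi relative entropy: supremum over all finite outcome sets and POVMs.
  Finite outcome sets are taken (w.l.o.g., up to relabelling) as finite subsets of nat.\<close>
definition measured_renyi :: "real \<Rightarrow> complex^'n^'n \<Rightarrow> complex^'n^'n \<Rightarrow> ereal" where
  "measured_renyi \<alpha> \<rho> \<sigma> =
     (SUP XM \<in> {(X :: nat set, M). povm X M}.
        renyi_div \<alpha> (fst XM) (meas_prob \<rho> (snd XM)) (meas_prob \<sigma> (snd XM)))"

definition outer :: "complex^'n \<Rightarrow> complex^'n \<Rightarrow> complex^'n^'n" where
  "outer v w = (\<chi> i j. v $ i * cnj (w $ j))"

definition rank_one_proj :: "complex^'n^'n \<Rightarrow> bool" where
  "rank_one_proj P \<longleftrightarrow> (\<exists>v. (\<Sum>i\<in>UNIV. cnj (v $ i) * v $ i) = 1 \<and> P = outer v v)"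

definition proj_family :: "('n \<Rightarrow> complex^'n^'n) \<Rightarrow> bool" where
  "proj_family P \<longleftrightarrow> (\<forall>i. rank_one_proj (P i)) \<and> (\<forall>i j. i \<noteq> j \<longrightarrow> P i ** P j = 0)"

definition proj_Q :: "real \<Rightarrow> complex^'n^'n \<Rightarrow> complex^'n^'n \<Rightarrow> ereal" where
  "proj_Q \<alpha> \<rho> \<sigma> =
     (if \<alpha> > 1 then (SUP P \<in> {P. proj_family P}. renyi_Q \<alpha> UNIV (meas_prob \<rho> P) (meas_prob \<sigma> P))
      else (INF P \<in> {P. proj_family P}. renyi_Q \<alpha> UNIV (meas_prob \<rho> P) (meas_prob \<sigma> P)))"

definition proj_renyi :: "real \<Rightarrow> complex^'n^'n \<Rightarrow> complex^'n^'n \<Rightarrow> ereal" where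
  "proj_renyi \<alpha> \<rho> \<sigma> = D_of_Q \<alpha> (proj_Q \<alpha> \<rho> \<sigma>)"

end

theory Submission
  imports Defs
begin

text \<open>
  A projective measurement is a POVM, so only one direction needs work. Given a POVM M with outcome
  probabilities P(x), Q(x), put h(x) = (P(x)/Q(x))^\<alpha>, let H be the sum of the h(x) M(x), and
  measure in an eigenbasis of H. The Renyi quantity of M equals
  \<alpha> \<Sum> h(x)^p P(x) + (1 - \<alpha>) \<Sum> h(x) Q(x) with p = 1 - 1/\<alpha>, while by weighted AM-GM
  the Renyi quantity of the eigenbasis is bounded, in the favourable direction, by
  \<alpha> tr (\<rho> H^p) + (1 - \<alpha>) tr (\<sigma> H). The two second terms agree, and the first
  ones compare by the operator Jensen inequality for t^p, which is operator concave for
  0 < p < 1 (\<alpha> > 1) and operator convex for -1 \<le> p < 0 (1/2 \<le> \<alpha> < 1). For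
  \<alpha> < 1/2 exchange \<rho> and \<sigma>.

  Jensen for t^p follows from Jensen for the resolvents 1/(t + s) by integrating over s, and Jensen
  for the inverse is the positivity of M(x) on the vector v - g(x) w with w = H^-1 v.
\<close>

section \<open>Spectral theorem for positive semidefinite matrices\<close>

text \<open>Only the real part of this form is the inner product \<open>\<bullet>\<close> of the
  vector type (\<open>Re_cip\<close>); orthogonality over the complex numbers needs all of
  it.\<close>

definition cip :: "complex^'n \<Rightarrow> complex^'n \<Rightarrow> complex" where
  "cip v w = (\<Sum>i\<in>UNIV. cnj (v $ i) * w $ i)"

lemma qform_eq_cip: "qform A v = cip v (A *v v)"
  by (simp add: qform_def cip_def)

lemma cip_add_left: "cip (u + v) w = cip u w + cip v w"
  by (simp add: cip_def algebra_simps sum.distrib)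

lemma cip_add_right: "cip w (u + v) = cip w u + cip w v"
  by (simp add: cip_def algebra_simps sum.distrib)

lemma cip_diff_left: "cip (u - v) w = cip u w - cip v w"
  by (simp add: cip_def algebra_simps sum_subtractf)

lemma cip_diff_right: "cip w (u - v) = cip w u - cip w v"
  by (simp add: cip_def algebra_simps sum_subtractf)

lemma cip_scale_left: "cip (c *s v) w = cnj c * cip v w"
  by (simp add: cip_def sum_distrib_left mult.assoc)

lemma cip_scale_right: "cip v (c *s w) = c * cip v w"
  by (simp add: cip_def sum_distrib_left mult_ac)

lemma cip_scaleR_left: "cip (r *\<^sub>R v) w = of_real r * cip v w"
  by (simp add: cip_def sum_distrib_left scaleR_conv_of_real[where 'a=complex] mult.assoc)

lemma cip_scaleR_right: "cip v (r *\<^sub>R w) = of_real r * cip v w"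
  by (simp add: cip_def sum_distrib_left scaleR_conv_of_real[where 'a=complex] mult_ac)

lemma cip_zero_left [simp]: "cip 0 w = 0" and cip_zero_right [simp]: "cip w 0 = 0"
  by (simp_all add: cip_def)

lemma cip_sum_left: "cip (\<Sum>k\<in>K. f k) w = (\<Sum>k\<in>K. cip (f k) w)"
  by (induction K rule: infinite_finite_induct) (simp_all add: cip_add_left)

lemma cip_sum_right: "cip w (\<Sum>k\<in>K. f k) = (\<Sum>k\<in>K. cip w (f k))"
  by (induction K rule: infinite_finite_induct) (simp_all add: cip_add_right)

lemma cnj_cip [simp]: "cnj (cip v w) = cip w v"
  by (simp add: cip_def mult.commute)

lemma cip_self: "cip v v = of_real ((norm v)\<^sup>2)"
proof -
  have "(norm v)\<^sup>2 = (\<Sum>i\<in>UNIV. (cmod (v $ i))\<^sup>2)"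
    by (simp add: norm_vec_def L2_set_def sum_nonneg)
  then show ?thesis
    by (simp add: cip_def complex_norm_square[symmetric] mult.commute)
qed

lemma Re_cip: "Re (cip v w) = v \<bullet> w"
  by (simp add: cip_def inner_vec_def inner_complex_def)

lemma matrix_vector_mult_scaleR: "A *v (r *\<^sub>R v) = r *\<^sub>R (A *v v)"
  for A :: "complex^'n^'m"
  by (simp add: vec_eq_iff matrix_vector_mult_def scaleR_sum_right)

lemma scaleR_matrix_vector_mult: "(r *\<^sub>R A) *v v = r *\<^sub>R (A *v v)"
  for A :: "complex^'n^'m"
  by (simp add: vec_eq_iff matrix_vector_mult_def scaleR_sum_right)

definition hermitian :: "complex^'n^'n \<Rightarrow> bool" where
  "hermitian A \<longleftrightarrow> (\<forall>v w. cip v (A *v w) = cip (A *v v) w)"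

text \<open>Polarisation: the form is real at \<open>v + w\<close> and at
  \<open>v + \<i> *s w\<close>, which makes the two off-diagonal values complex conjugates.\<close>

lemma psd_imp_hermitian:
  fixes A :: "complex^'n^'n"
  assumes "psd A"
  shows "hermitian A"
  unfolding hermitian_def
proof (intro allI)
  fix v w :: "complex^'n"
  define a where "a = cip v (A *v w)"
  define b where "b = cip w (A *v v)"
  have im: "Im (cip u (A *v u)) = 0" for u
    using assms by (simp add: psd_def qform_eq_cip)
  have "cip (v + w) (A *v (v + w)) = cip v (A *v v) + a + b + cip w (A *v w)"
    by (simp add: a_def b_def cip_add_left cip_add_right matrix_vector_right_distrib)
  then have 1: "Im a + Im b = 0"
    using im[of "v + w"] im[of v] im[of w] by simp
  have "cip (v + \<i> *s w) (A *v (v + \<i> *s w)) = cip v (A *v v) + \<i> * a - \<i> * b + cip w (A *v w)"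
    by (simp add: a_def b_def cip_add_left cip_add_right matrix_vector_right_distrib
        cip_scale_left cip_scale_right vector_scalar_commute algebra_simps)
  then have 2: "Re a - Re b = 0"
    using im[of "v + \<i> *s w"] im[of v] im[of w] by simp
  have "a = cnj b" using 1 2 by (simp add: complex_eq_iff)
  then show "cip v (A *v w) = cip (A *v v) w" by (simp add: a_def b_def)
qed

section \<open>Orthonormal eigenbases of Hermitian matrices\<close>

definition orthonormal_on :: "'k set \<Rightarrow> ('k \<Rightarrow> complex^'n) \<Rightarrow> bool" where
  "orthonormal_on S e \<longleftrightarrow> (\<forall>i\<in>S. \<forall>j\<in>S. cip (e i) (e j) = (if i = j then 1 else 0))"

text \<open>The conjugated \<open>e i\<close> with \<open>i \<in> S\<close> are rows of a square
  matrix whose other rows are zero. It is singular, and a kernel vector is orthogonal to all of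
  them.\<close>

lemma exists_orthogonal_vector:
  fixes e :: "'n::finite \<Rightarrow> complex^'n"
  assumes "S \<noteq> UNIV"
  shows "\<exists>v. v \<noteq> 0 \<and> (\<forall>i\<in>S. cip (e i) v = 0)"
proof -
  define B :: "complex^'n^'n" where "B = (\<chi> i j. if i \<in> S then cnj (e i $ j) else 0)"
  obtain k where "k \<notin> S" using assms by auto
  then have "row k B = 0" by (simp add: row_def B_def vec_eq_iff)
  then have "det B = 0" by (rule det_zero_row)
  then have "\<not> invertible B" by (simp add: invertible_det_nz)
  then have "\<not> (\<forall>x. B *v x = 0 \<longrightarrow> x = 0)"
    using matrix_left_invertible_ker[of B] invertible_left_inverse[of B] by blast
  then obtain v where v: "v \<noteq> 0" "B *v v = 0" by auto
  have "cip (e i) v = 0" if "i \<in> S" for i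
  proof -
    have "cip (e i) v = (B *v v) $ i"
      using that by (simp add: cip_def B_def matrix_vector_mult_def)
    then show ?thesis using v by simp
  qed
  with v show ?thesis by blast
qed

text \<open>Rayleigh quotient: a maximiser of the quadratic form on the unit sphere of the
  complement \<open>V\<close> of the known eigenvectors is an eigenvector, since a nonzero residual
  would allow a better vector.\<close>

lemma hermitian_eigenvector_on_complement:
  fixes A :: "complex^'n^'n" and e :: "'n \<Rightarrow> complex^'n"
  assumes A: "hermitian A" and "S \<noteq> UNIV"
    and eig: "\<And>i. i \<in> S \<Longrightarrow> A *v e i = m i *\<^sub>R e i"
  shows "\<exists>u r. cip u u = 1 \<and> (\<forall>i\<in>S. cip (e i) u = 0) \<and> A *v u = r *\<^sub>R u"
proof -
  define V where "V = {v. \<forall>i\<in>S. cip (e i) v = 0}"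
  define q where "q v = v \<bullet> (A *v v)" for v
  have scaleR: "A *v (r *\<^sub>R v) = r *\<^sub>R (A *v v)" for r v
    by (rule matrix_vector_mult_scaleR)
  have "V = (\<Inter>i\<in>S. {v. cip (e i) v = 0})" by (auto simp: V_def)
  moreover have "closed {v. cip (e i) v = 0}" for i
    unfolding cip_def by (intro closed_Collect_eq continuous_intros)
  ultimately have "closed V" by auto
  then have comp: "compact (sphere 0 1 \<inter> V)" by (intro compact_Int_closed) auto
  obtain v where v: "v \<noteq> 0" "v \<in> V"
    using exists_orthogonal_vector[OF \<open>S \<noteq> UNIV\<close>] by (auto simp: V_def)
  have "(1 / norm v) *\<^sub>R v \<in> sphere 0 1 \<inter> V"
    using v by (simp add: V_def cip_scaleR_right)
  then have ne: "sphere 0 1 \<inter> V \<noteq> {}" by blast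
  have "continuous_on (sphere 0 1 \<inter> V) q"
    unfolding q_def inner_vec_def matrix_vector_mult_def by (simp, intro continuous_intros)
  then obtain u where u: "norm u = 1" "u \<in> V"
    and max: "\<And>v. norm v = 1 \<Longrightarrow> v \<in> V \<Longrightarrow> q v \<le> q u"
    using continuous_attains_sup[OF comp ne] by fastforce
  define r where "r = q u"
  have qle: "q v \<le> r * (norm v)\<^sup>2" if "v \<in> V" for v
  proof (cases "v = 0")
    case False
    have "q ((1 / norm v) *\<^sub>R v) \<le> r"
      unfolding r_def using that False by (intro max) (simp_all add: V_def cip_scaleR_right)
    then show ?thesis
      using False by (simp add: q_def scaleR field_simps power2_eq_square)
  qed (simp add: q_def)
  \<comment> \<open>The residual of the eigenvalue equation. It lies in \<open>V\<close> and is
    orthogonal to \<open>u\<close>, hence is an admissible direction of variation.\<close>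
  define w where "w = A *v u - r *\<^sub>R u"
  have "cip (e i) (A *v u) = 0" if "i \<in> S" for i
  proof -
    have "cip (e i) (A *v u) = cip (A *v e i) u" using A by (simp add: hermitian_def)
    also have "\<dots> = 0" using that u by (simp add: eig cip_scaleR_left V_def)
    finally show ?thesis .
  qed
  then have wV: "w \<in> V"
    using u by (simp add: V_def w_def cip_diff_right cip_scaleR_right)
  have uu: "u \<bullet> u = 1" using u by (simp add: dot_square_norm)
  have uw: "u \<bullet> w = 0" by (simp add: w_def inner_diff_right uu r_def q_def)
  have wAu: "w \<bullet> (A *v u) = w \<bullet> w"
    using uw by (simp add: w_def inner_diff_right inner_commute)
  have uAw: "u \<bullet> (A *v w) = w \<bullet> w"
    using A wAu by (metis Re_cip hermitian_def inner_commute)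
  \<comment> \<open>Moving from \<open>u\<close> along \<open>w\<close> raises \<open>q\<close> at
    first order by \<open>2 * t * (w \<bullet> w)\<close>, while maximality leaves room only at
    second order in \<open>t\<close>.\<close>
  have *: "2 * t * (w \<bullet> w) \<le> t\<^sup>2 * (r * (w \<bullet> w) - q w)" for t
  proof -
    have "u + t *\<^sub>R w \<in> V"
      using u wV by (simp add: V_def cip_add_right cip_scaleR_right)
    from qle[OF this] have "q (u + t *\<^sub>R w) \<le> r * ((u + t *\<^sub>R w) \<bullet> (u + t *\<^sub>R w))"
      by (simp add: dot_square_norm)
    moreover have "q (u + t *\<^sub>R w) = r + 2 * t * (w \<bullet> w) + t\<^sup>2 * q w"
      unfolding q_def matrix_vector_right_distrib scaleR inner_add_left inner_add_right
      by (simp add: wAu uAw r_def q_def power2_eq_square algebra_simps)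
    moreover have "(u + t *\<^sub>R w) \<bullet> (u + t *\<^sub>R w) = 1 + t\<^sup>2 * (w \<bullet> w)"
      by (simp add: inner_add_left inner_add_right uu uw inner_commute[of w u] power2_eq_square)
    ultimately have "r + 2 * t * (w \<bullet> w) + t\<^sup>2 * q w \<le> r * (1 + t\<^sup>2 * (w \<bullet> w))"
      by simp
    then show ?thesis by (simp add: algebra_simps)
  qed
  have "w \<bullet> w = 0"
  proof (rule ccontr)
    assume "w \<bullet> w \<noteq> 0"
    then have pos: "w \<bullet> w > 0" by (simp add: order_less_le)
    define d where "d = \<bar>r * (w \<bullet> w) - q w\<bar> + 1"
    have d: "d > 0" "r * (w \<bullet> w) - q w \<le> d" by (auto simp: d_def)
    \<comment> \<open>This \<open>t\<close> turns the upper bound \<open>t\<^sup>2 * d\<close> into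
      \<open>t * (w \<bullet> w)\<close>, half of the left side.\<close>
    define t where "t = (w \<bullet> w) / d"
    have t: "t > 0" using pos d by (simp add: t_def)
    have "2 * t * (w \<bullet> w) \<le> t\<^sup>2 * d"
      using *[of t] mult_left_mono[OF d(2) zero_le_power2[of t]] by linarith
    also have "\<dots> = t * (w \<bullet> w)" using d by (simp add: t_def power2_eq_square)
    finally show False using mult_pos_pos[OF t pos] by linarith
  qed
  then have "A *v u = r *\<^sub>R u" by (simp add: w_def)
  moreover have "cip u u = 1" by (simp add: cip_self u)
  ultimately show ?thesis using u by (auto simp: V_def)
qed

lemma hermitian_orthonormal_eigenbasis:
  fixes A :: "complex^'n^'n"
  assumes "hermitian A"
  shows "\<exists>(e :: 'n \<Rightarrow> complex^'n) m. orthonormal_on UNIV e \<and> (\<forall>i. A *v e i = m i *\<^sub>R e i)"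
proof -
  \<comment> \<open>Eigenvectors are added one index at a time; outside \<open>S\<close> the values
    of \<open>e\<close> and \<open>m\<close> are arbitrary.\<close>
  have "\<exists>(e :: 'n \<Rightarrow> complex^'n) m. orthonormal_on S e \<and> (\<forall>i\<in>S. A *v e i = m i *\<^sub>R e i)"
    for S :: "'n set"
    using finite[of S]
  proof (induction S rule: finite_induct)
    case empty
    then show ?case by (simp add: orthonormal_on_def)
  next
    case (insert k S)
    then obtain e :: "'n \<Rightarrow> complex^'n" and m
      where e: "orthonormal_on S e" "\<And>i. i \<in> S \<Longrightarrow> A *v e i = m i *\<^sub>R e i" by blast
    have "S \<noteq> UNIV" using insert by auto
    then obtain u r where u: "cip u u = 1" "\<forall>i\<in>S. cip (e i) u = 0" "A *v u = r *\<^sub>R u"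
      using hermitian_eigenvector_on_complement[OF assms, of S e m] e(2) by blast
    have "\<forall>i\<in>S. cip u (e i) = 0" using u(2) by (metis cnj_cip complex_cnj_zero)
    then have "orthonormal_on (insert k S) (e(k := u))"
      using e(1) u insert.hyps by (auto simp: orthonormal_on_def)
    moreover have "\<forall>i\<in>insert k S. A *v (e(k := u)) i = (m(k := r)) i *\<^sub>R (e(k := u)) i"
      using e(2) u(3) insert.hyps by auto
    ultimately show ?case by blast
  qed
  from this[of UNIV] show ?thesis by simp
qed

text \<open>With the vectors as columns of \<open>U\<close>, orthonormality says that the adjoint
  \<open>V\<close> is a left inverse. For square matrices it is also a right inverse, which is
  completeness.\<close>

lemma orthonormal_resolution:
  fixes e :: "'n::finite \<Rightarrow> complex^'n"
  assumes "orthonormal_on UNIV e"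
  shows "(\<Sum>k\<in>UNIV. outer (e k) (e k)) = mat 1"
proof -
  define U :: "complex^'n^'n" where "U = (\<chi> i j. e j $ i)"
  define V :: "complex^'n^'n" where "V = (\<chi> i j. cnj (e i $ j))"
  have "V ** U = mat 1"
    using assms by (simp add: vec_eq_iff matrix_matrix_mult_def U_def V_def mat_def
        orthonormal_on_def cip_def)
  then have "U ** V = mat 1" by (simp add: matrix_left_right_inverse)
  moreover have "U ** V = (\<Sum>k\<in>UNIV. outer (e k) (e k))"
    by (simp add: vec_eq_iff matrix_matrix_mult_def U_def V_def outer_def)
  ultimately show ?thesis by simp
qed

lemma outer_mult_vector: "outer v w *v x = cip w x *s v"
  by (simp add: vec_eq_iff outer_def matrix_vector_mult_def cip_def sum_distrib_left mult_ac)

lemma matrix_vector_mult_sum_left: "(\<Sum>x\<in>X. M x) *v v = (\<Sum>x\<in>X. M x *v v)"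
  by (induction X rule: infinite_finite_induct) (simp_all add: matrix_vector_mult_add_rdistrib)

lemma orthonormal_expansion:
  fixes e :: "'n::finite \<Rightarrow> complex^'n"
  assumes "orthonormal_on UNIV e"
  shows "v = (\<Sum>k\<in>UNIV. cip (e k) v *s e k)"
proof -
  have "(\<Sum>k\<in>UNIV. outer (e k) (e k)) *v v = v"
    by (simp add: orthonormal_resolution[OF assms])
  then show ?thesis by (simp add: matrix_vector_mult_sum_left outer_mult_vector)
qed

lemma spectral_decomposition:
  fixes A :: "complex^'n^'n"
  assumes e: "orthonormal_on UNIV (e :: 'n \<Rightarrow> complex^'n)" and eig: "\<And>i. A *v e i = m i *\<^sub>R e i"
  shows "A = (\<Sum>k\<in>UNIV. m k *\<^sub>R outer (e k) (e k))"
proof -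
  have "A *v v = (\<Sum>k\<in>UNIV. m k *\<^sub>R outer (e k) (e k)) *v v" for v
  proof -
    have "A *v v = (\<Sum>k\<in>UNIV. A *v (cip (e k) v *s e k))"
      by (subst orthonormal_expansion[OF e, of v])
        (simp add: matrix_vector_mult_sum_left vec.linear_sum matrix_vector_mul_linear_gen)
    also have "\<dots> = (\<Sum>k\<in>UNIV. m k *\<^sub>R outer (e k) (e k)) *v v"
      unfolding matrix_vector_mult_sum_left
      by (intro sum.cong refl) (simp add: vec_eq_iff vector_scalar_commute eig outer_mult_vector
          scaleR_matrix_vector_mult)
    finally show ?thesis .
  qed
  then show ?thesis by (simp add: matrix_eq)
qed

section \<open>Traces and measurements\<close>

lemma linear_trace_mult: "linear (\<lambda>A. Re (mtrace (A ** \<rho>)))"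
  by (rule linearI)
    (simp_all add: mtrace_def matrix_matrix_mult_def sum.distrib sum_subtractf
      sum_distrib_left algebra_simps)

lemma trace_mult_sum_scaleR:
  "Re (mtrace ((\<Sum>x\<in>X. c x *\<^sub>R M x) ** \<rho>)) = (\<Sum>x\<in>X. c x * meas_prob \<rho> M x)"
  using linear_sum[OF linear_trace_mult[of \<rho>], of "\<lambda>x. c x *\<^sub>R M x" X]
  by (simp add: meas_prob_def linear_scale[OF linear_trace_mult])

lemma sum_meas_prob:
  assumes "(\<Sum>x\<in>X. M x) = mat 1"
  shows "(\<Sum>x\<in>X. meas_prob \<rho> M x) = Re (mtrace \<rho>)"
  using trace_mult_sum_scaleR[of "\<lambda>_. 1" M X \<rho>] assms by simp

lemma psd_orthonormal_eigenbasis: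
  fixes A :: "complex^'n^'n"
  assumes "psd A"
  obtains e :: "'n \<Rightarrow> complex^'n" and m where "orthonormal_on UNIV e"
    "\<And>i. A *v e i = m i *\<^sub>R e i" "\<And>i. m i \<ge> 0" "A = (\<Sum>i\<in>UNIV. m i *\<^sub>R outer (e i) (e i))"
proof -
  obtain e :: "'n \<Rightarrow> complex^'n" and m
    where e: "orthonormal_on UNIV e" "\<And>i. A *v e i = m i *\<^sub>R e i"
    using hermitian_orthonormal_eigenbasis[OF psd_imp_hermitian[OF assms]] by blast
  have "qform A (e i) = of_real (m i)" for i
    using e by (simp add: qform_eq_cip cip_scaleR_right orthonormal_on_def)
  then have "m i \<ge> 0" for i
    using assms unfolding psd_def by (metis Re_complex_of_real)
  then show thesis using that e spectral_decomposition[OF e] by blast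
qed

text \<open>Weights and vectors are the spectral data of \<open>\<rho>\<close>. Inequalities between
  quadratic forms thereby pass to traces against \<open>\<rho>\<close>.\<close>

lemma psd_trace_mult_eq_sum_qform:
  fixes \<rho> :: "complex^'n^'n"
  assumes "psd \<rho>"
  obtains f :: "'n \<Rightarrow> complex^'n" and l where "\<And>k. l k \<ge> 0"
    "\<And>A. Re (mtrace (A ** \<rho>)) = (\<Sum>k\<in>UNIV. l k * Re (qform A (f k)))"
proof -
  obtain f :: "'n \<Rightarrow> complex^'n" and l where l: "\<And>k. l k \<ge> 0"
    and \<rho>: "\<rho> = (\<Sum>k\<in>UNIV. l k *\<^sub>R outer (f k) (f k))"
    by (rule psd_orthonormal_eigenbasis[OF assms]) blast
  have "mtrace (A ** \<rho>) = (\<Sum>k\<in>UNIV. l k *\<^sub>R qform A (f k))" for A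
  proof -
    have "mtrace (A ** \<rho>) = (\<Sum>i\<in>UNIV. \<Sum>j\<in>UNIV. \<Sum>k\<in>UNIV. l k *\<^sub>R (cnj (f k $ i) * (A $ i $ j * f k $ j)))"
      by (simp add: \<rho> mtrace_def matrix_matrix_mult_def outer_def sum_distrib_left mult_ac)
    also have "\<dots> = (\<Sum>i\<in>UNIV. \<Sum>k\<in>UNIV. \<Sum>j\<in>UNIV. l k *\<^sub>R (cnj (f k $ i) * (A $ i $ j * f k $ j)))"
      by (intro sum.cong refl sum.swap)
    also have "\<dots> = (\<Sum>k\<in>UNIV. \<Sum>i\<in>UNIV. \<Sum>j\<in>UNIV. l k *\<^sub>R (cnj (f k $ i) * (A $ i $ j * f k $ j)))"
      by (rule sum.swap)
    also have "\<dots> = (\<Sum>k\<in>UNIV. l k *\<^sub>R qform A (f k))"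
      by (simp add: qform_def matrix_vector_mult_def scaleR_sum_right sum_distrib_left)
    finally show ?thesis .
  qed
  then have "Re (mtrace (A ** \<rho>)) = (\<Sum>k\<in>UNIV. l k * Re (qform A (f k)))" for A by simp
  then show thesis using l that by blast
qed

lemma meas_prob_nonneg:
  fixes \<rho> :: "complex^'n^'n"
  assumes "psd \<rho>" "psd (M x)"
  shows "meas_prob \<rho> M x \<ge> 0"
proof -
  obtain f :: "'n \<Rightarrow> complex^'n" and l where "\<And>k. l k \<ge> 0"
    "\<And>A. Re (mtrace (A ** \<rho>)) = (\<Sum>k\<in>UNIV. l k * Re (qform A (f k)))"
    by (rule psd_trace_mult_eq_sum_qform[OF assms(1)]) blast
  then show ?thesis
    using assms(2) by (auto simp: meas_prob_def psd_def intro!: sum_nonneg)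
qed

lemma qform_outer: "qform (outer w w) v = of_real ((cmod (cip w v))\<^sup>2)"
proof -
  have "qform (outer w w) v = cip w v * cnj (cip w v)"
    by (simp only: qform_eq_cip outer_mult_vector cip_scale_right cnj_cip)
  then show ?thesis by (simp only: complex_norm_square)
qed

lemma psd_outer: "psd (outer w w)"
  by (simp add: psd_def qform_outer)

lemma psd_sum_scaleR:
  assumes "\<And>x. x \<in> X \<Longrightarrow> psd (M x)" "\<And>x. x \<in> X \<Longrightarrow> c x \<ge> 0"
  shows "psd (\<Sum>x\<in>X. c x *\<^sub>R M x)"
proof -
  have "qform (\<Sum>x\<in>X. c x *\<^sub>R M x) v = (\<Sum>x\<in>X. c x *\<^sub>R qform (M x) v)" for v
    by (simp add: qform_eq_cip matrix_vector_mult_sum_left cip_sum_right scaleR_matrix_vector_mult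
        cip_scaleR_right scaleR_conv_of_real[where 'a=complex])
  then show ?thesis using assms by (auto simp: psd_def intro!: sum_nonneg)
qed

section \<open>Projective measurements and orthonormal bases\<close>

lemma orthonormal_proj_family:
  assumes "orthonormal_on UNIV e"
  shows "proj_family (\<lambda>i. outer (e i) (e i))"
proof -
  have "outer (e i) (e i) ** outer (e j) (e j) = 0" if "i \<noteq> j" for i j
  proof -
    have "(outer (e i) (e i) ** outer (e j) (e j)) *v v = 0 *v v" for v
      using that assms
      by (simp add: matrix_vector_mul_assoc[symmetric] outer_mult_vector cip_scale_right orthonormal_on_def)
    then show ?thesis by (subst matrix_eq) simp
  qed
  moreover have "rank_one_proj (outer (e i) (e i))" for i
    using assms unfolding rank_one_proj_def cip_def[symmetric] orthonormal_on_def
    by (intro exI[of _ "e i"]) simp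
  ultimately show ?thesis by (simp add: proj_family_def)
qed

lemma proj_family_orthonormal:
  fixes P :: "'n \<Rightarrow> complex^'n^'n"
  assumes "proj_family P"
  obtains e where "orthonormal_on UNIV e" "\<And>i. P i = outer (e i) (e i)"
proof -
  obtain e where e: "\<And>i. cip (e i) (e i) = 1" "\<And>i. P i = outer (e i) (e i)"
    using assms unfolding proj_family_def rank_one_proj_def cip_def[symmetric] by metis
  have "cip (e i) (e j) = 0" if "i \<noteq> j" for i j
  proof -
    have "(P i ** P j) *v e j = 0" using assms that by (simp add: proj_family_def)
    then have "cip (e i) (e j) *s e i = 0"
      by (simp add: matrix_vector_mul_assoc[symmetric] outer_mult_vector cip_scale_right e)
    moreover have "e i \<noteq> 0" using e(1)[of i] by auto
    ultimately show ?thesis by simp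
  qed
  then have "orthonormal_on UNIV e" using e(1) by (auto simp: orthonormal_on_def)
  then show thesis using that e(2) by blast
qed

text \<open>The definition of \<open>proj_family\<close> asks only for orthogonality. The unit
  vectors are indexed by \<open>'n\<close>, hence as many as the dimension, and this forces the
  projectors to sum to the identity.\<close>

lemma proj_family_povm:
  fixes P :: "'n \<Rightarrow> complex^'n^'n"
  assumes "proj_family P"
  shows "povm UNIV P"
proof -
  obtain e where e: "orthonormal_on UNIV e" "\<And>i. P i = outer (e i) (e i)"
    by (rule proj_family_orthonormal[OF assms]) blast
  then show ?thesis by (simp add: povm_def psd_outer orthonormal_resolution)
qed

section \<open>Operator Jensen inequality\<close>

text \<open>Operator Jensen for 1/t: with H the sum of the \<open>g x *\<^sub>R M x\<close>, the
  left side is the quadratic form of the inverse of H at \<open>v\<close>.\<close>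

lemma resolvent_Jensen_vector:
  fixes M :: "'x \<Rightarrow> complex^'n^'n" and e :: "'n \<Rightarrow> complex^'n"
  assumes M: "povm X M" and g: "\<And>x. x \<in> X \<Longrightarrow> g x > 0"
    and e: "orthonormal_on UNIV e" and m: "\<And>i. m i > 0"
    and eig: "\<And>i. (\<Sum>x\<in>X. g x *\<^sub>R M x) *v e i = m i *\<^sub>R e i"
  shows "(\<Sum>i\<in>UNIV. (cmod (cip (e i) v))\<^sup>2 / m i) \<le> (\<Sum>x\<in>X. Re (qform (M x) v) / g x)"
proof -
  \<comment> \<open>The inverse of H applied to \<open>v\<close>, written in the eigenbasis.\<close>
  define w where "w = (\<Sum>i\<in>UNIV. (1 / m i) *\<^sub>R (cip (e i) v *s e i))"
  have m0: "m i \<noteq> 0" for i using m[of i] by simp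
  have "(\<Sum>x\<in>X. g x *\<^sub>R M x) *v w
      = (\<Sum>i\<in>UNIV. (\<Sum>x\<in>X. g x *\<^sub>R M x) *v ((1 / m i) *\<^sub>R (cip (e i) v *s e i)))"
    unfolding w_def by (rule vec.linear_sum[OF matrix_vector_mul_linear_gen])
  also have "\<dots> = (\<Sum>i\<in>UNIV. cip (e i) v *s e i)"
    by (intro sum.cong refl)
      (simp add: matrix_vector_mult_scaleR vector_scalar_commute eig vec_eq_iff m0)
  finally have Hw: "(\<Sum>x\<in>X. g x *\<^sub>R M x) *v w = v"
    using orthonormal_expansion[OF e, of v] by simp
  have "cip w v = (\<Sum>i\<in>UNIV. (1 / m i) *\<^sub>R (cip (e i) v * cnj (cip (e i) v)))"
    by (simp add: w_def cip_sum_left cip_scaleR_left cip_scale_left scaleR_conv_of_real[where 'a=complex] mult_ac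
        del: of_real_divide)
  then have wv: "Re (cip w v) = (\<Sum>i\<in>UNIV. (cmod (cip (e i) v))\<^sup>2 / m i)"
    by (simp add: complex_norm_square[symmetric] del: cnj_cip)
  \<comment> \<open>Expanding the form of \<open>M x\<close> at \<open>v - g x *\<^sub>R w\<close>
    gives a bound whose left side can be summed over \<open>X\<close> from the sums of the
    \<open>M x\<close> and of the \<open>g x *\<^sub>R M x\<close> alone.\<close>
  have pt: "2 * Re (cip w (M x *v v)) - g x * Re (cip w (M x *v w)) \<le> Re (qform (M x) v) / g x"
    if x: "x \<in> X" for x
  proof -
    have psd: "psd (M x)" using M x by (simp add: povm_def)
    have "cip v (M x *v w) = cnj (cip w (M x *v v))"
      using psd_imp_hermitian[OF psd] by (simp add: hermitian_def)
    then have sym: "Re (cip v (M x *v w)) = Re (cip w (M x *v v))" by (metis cnj.sel(1))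
    have "0 \<le> Re (qform (M x) (v - g x *\<^sub>R w))" using psd by (simp add: psd_def)
    also have "\<dots> = Re (qform (M x) v) - 2 * g x * Re (cip w (M x *v v)) + (g x)\<^sup>2 * Re (cip w (M x *v w))"
      by (simp add: qform_eq_cip matrix_vector_mult_diff_distrib matrix_vector_mult_scaleR
          cip_diff_left cip_diff_right cip_scaleR_left cip_scaleR_right sym power2_eq_square algebra_simps)
    finally have "g x * (2 * Re (cip w (M x *v v)) - g x * Re (cip w (M x *v w))) \<le> Re (qform (M x) v)"
      by (simp add: power2_eq_square algebra_simps)
    then show ?thesis using g[OF x] by (simp add: le_divide_eq mult.commute)
  qed
  have 1: "(\<Sum>x\<in>X. Re (cip w (M x *v v))) = Re (cip w v)"
  proof -
    have "(\<Sum>x\<in>X. M x *v v) = v"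
      using M by (simp add: povm_def matrix_vector_mult_sum_left[symmetric])
    then show ?thesis by (metis Re_sum cip_sum_right)
  qed
  have 2: "(\<Sum>x\<in>X. g x * Re (cip w (M x *v w))) = Re (cip w v)"
  proof -
    have "(\<Sum>x\<in>X. g x * Re (cip w (M x *v w))) = Re (cip w ((\<Sum>x\<in>X. g x *\<^sub>R M x) *v w))"
      by (simp add: matrix_vector_mult_sum_left scaleR_matrix_vector_mult cip_sum_right cip_scaleR_right)
    then show ?thesis by (simp only: Hw)
  qed
  \<comment> \<open>The two parts sum to \<open>2 * Re (cip w v)\<close> and
    \<open>- Re (cip w v)\<close>.\<close>
  have "Re (cip w v) = (\<Sum>x\<in>X. 2 * Re (cip w (M x *v v)) - g x * Re (cip w (M x *v w)))"
    by (simp add: sum_subtractf sum_distrib_left[symmetric] 1 2)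
  also have "\<dots> \<le> (\<Sum>x\<in>X. Re (qform (M x) v) / g x)" by (intro sum_mono pt)
  finally show ?thesis by (simp add: wv)
qed

text \<open>As the \<open>M x\<close> sum to the identity, replacing \<open>h x\<close> by
  \<open>h x + s\<close> shifts their combination by \<open>s\<close> and keeps its eigenbasis.
  Positivity is asked of the shifted values, which covers \<open>s > 0\<close> with vanishing
  \<open>h x\<close> as well as \<open>s = 0\<close> with positive \<open>h x\<close>.\<close>

lemma resolvent_Jensen_trace:
  fixes M :: "'x \<Rightarrow> complex^'n^'n" and e :: "'n \<Rightarrow> complex^'n"
  assumes "psd \<rho>" and M: "povm X M" and h: "\<And>x. x \<in> X \<Longrightarrow> h x + s > 0"
    and e: "orthonormal_on UNIV e" and m: "\<And>i. m i + s > 0"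
    and eig: "\<And>i. (\<Sum>x\<in>X. h x *\<^sub>R M x) *v e i = m i *\<^sub>R e i"
  shows "(\<Sum>i\<in>UNIV. meas_prob \<rho> (\<lambda>i. outer (e i) (e i)) i / (m i + s))
    \<le> (\<Sum>x\<in>X. meas_prob \<rho> M x / (h x + s))"
proof -
  obtain f :: "'n \<Rightarrow> complex^'n" and l where l: "\<And>k. l k \<ge> 0"
    and tr: "\<And>A. Re (mtrace (A ** \<rho>)) = (\<Sum>k\<in>UNIV. l k * Re (qform A (f k)))"
    by (rule psd_trace_mult_eq_sum_qform[OF assms(1)]) blast
  have swap: "(\<Sum>x\<in>Y. meas_prob \<rho> N x / g x) = (\<Sum>k\<in>UNIV. l k * (\<Sum>x\<in>Y. Re (qform (N x) (f k)) / g x))"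
    for Y and N :: "'y \<Rightarrow> complex^'n^'n" and g
    unfolding meas_prob_def tr sum_divide_distrib sum_distrib_left by (subst sum.swap) simp
  have "(\<Sum>x\<in>X. (h x + s) *\<^sub>R M x) = (\<Sum>x\<in>X. h x *\<^sub>R M x) + s *\<^sub>R mat 1"
    using M by (simp add: povm_def scaleR_add_left sum.distrib scaleR_sum_right[symmetric])
  then have "(\<Sum>x\<in>X. (h x + s) *\<^sub>R M x) *v e i = (m i + s) *\<^sub>R e i" for i
    by (simp add: matrix_vector_mult_add_rdistrib eig scaleR_matrix_vector_mult scaleR_add_left)
  from resolvent_Jensen_vector[OF M h e m this]
  have "(\<Sum>i\<in>UNIV. (cmod (cip (e i) v))\<^sup>2 / (m i + s)) \<le> (\<Sum>x\<in>X. Re (qform (M x) v) / (h x + s))" for v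
    by simp
  then show ?thesis
    unfolding swap qform_outer by (intro sum_mono mult_left_mono l) simp
qed

text \<open>By scaling, c is the integral for t = 1; its value is never needed.\<close>

lemma has_bochner_integral_Stieltjes_powr:
  fixes q :: real
  assumes q: "0 < q" "q < 1"
  shows "\<exists>c>0. \<forall>t>0. has_bochner_integral lborel
           (\<lambda>s. if s > 0 then s powr (q - 1) / (t + s) else 0) (c * t powr (q - 1))"
proof -
  define F where "F t s = (if s > 0 then s powr (q - 1) / (t + s) else 0)" for t s :: real
  have meas [measurable]: "F t \<in> borel_measurable borel" for t
    unfolding F_def[abs_def] by measurable
  have F_nonneg: "F t s \<ge> 0" if "t > 0" for t s using that by (simp add: F_def)
  \<comment> \<open>Near zero the integrand is dominated by \<open>s powr (q - 1)\<close>,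
    integrable there since \<open>q > 0\<close>.\<close>
  have int1: "integrable lborel (\<lambda>s. indicator {0..1} s * s powr (q - 1))"
  proof (rule integrableI_nonneg)
    have "((\<lambda>s. s powr (q - 1)) has_integral 1 powr (q - 1 + 1) / (q - 1 + 1)) {0..1}"
      using q by (intro has_integral_powr_from_0) auto
    from nn_integral_has_integral_lebesgue[OF _ this]
    show "(\<integral>\<^sup>+s. ennreal (indicator {0..1} s * s powr (q - 1)) \<partial>lborel) < \<infinity>"
      by simp
  qed auto
  \<comment> \<open>Near infinity it is dominated by \<open>s powr (q - 2)\<close>, integrable there
    since \<open>q < 1\<close>.\<close>
  have int2: "integrable lborel (\<lambda>s. indicator {1..} s * s powr (q - 2))"
  proof (rule integrableI_nonneg)
    have "((\<lambda>s. s powr (q - 2)) has_integral - (1 powr (q - 2 + 1)) / (q - 2 + 1)) {1..}"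
      using q by (intro has_integral_powr_to_inf) auto
    from nn_integral_has_integral_lebesgue[OF _ this]
    show "(\<integral>\<^sup>+s. ennreal (indicator {1..} s * s powr (q - 2)) \<partial>lborel) < \<infinity>"
      by simp
  qed auto
  have int: "integrable lborel (F 1)"
  proof (rule Bochner_Integration.integrable_bound[OF Bochner_Integration.integrable_add[OF int1 int2]])
    have "F 1 s \<le> indicator {0..1} s * s powr (q - 1) + indicator {1..} s * s powr (q - 2)" for s
    proof (cases "s > 0")
      case s: True
      have 1: "F 1 s \<le> s powr (q - 1)"
        using s by (simp add: F_def divide_le_eq mult_le_cancel_left1)
      have "s powr (q - 2) = s powr (q - 1) / s"
        using s powr_diff[of s "q - 1" 1] by (simp add: algebra_simps)
      then have 2: "F 1 s \<le> s powr (q - 2)"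
        using s by (simp add: F_def frac_le)
      show ?thesis
        using s 1 2 by (cases "s \<le> 1") (auto simp: indicator_def intro: add_increasing2)
    qed (simp add: F_def)
    then show "AE s in lborel. norm (F 1 s)
        \<le> norm (indicator {0..1} s * s powr (q - 1) + indicator {1..} s * s powr (q - 2))"
      using F_nonneg[of 1] by (intro AE_I2) (simp add: abs_of_nonneg)
  qed simp
  define c where "c = integral\<^sup>L lborel (F 1)"
  \<comment> \<open>Between 1 and 2 the integrand is at least 1/2 times 1/3, so its integral is
    strictly positive.\<close>
  have "integral\<^sup>L lborel (\<lambda>s. indicator {1..2::real} s * (1 / 6)) \<le> c"
    unfolding c_def
  proof (rule integral_mono[OF _ int])
    fix s :: real
    have "1 / 6 \<le> F 1 s" if "1 \<le> s" "s \<le> 2"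
    proof -
      have "1 / 6 \<le> (1 / 2) / (1 + s)" using that by (simp add: field_simps)
      also have "1 / 2 \<le> s powr (- 1)" using that by (simp add: powr_minus_divide frac_le)
      also have "s powr (- 1) \<le> s powr (q - 1)" using that q by (intro powr_mono) auto
      finally show ?thesis using that by (simp add: F_def divide_right_mono)
    qed
    then show "indicator {1..2} s * (1 / 6) \<le> F 1 s"
      using F_nonneg[of 1 s] by (auto simp: indicator_def)
  qed simp
  then have c: "c > 0" by simp
  have "has_bochner_integral lborel (F t) (c * t powr (q - 1))" if t: "t > 0" for t
  proof -
    \<comment> \<open>\<open>F\<close> is homogeneous of degree \<open>q - 2\<close>; substituting
      \<open>t * s\<close> for the integration variable contributes one more factor
      \<open>t\<close>.\<close>
    have scale: "F t (0 + t * s) = t powr (q - 2) * F 1 s" for s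
    proof (cases "s > 0")
      case True
      have "t powr (q - 2) = t powr (q - 1) / t"
        using t powr_diff[of t "q - 1" 1] by (simp add: algebra_simps)
      moreover have "t + t * s = t * (1 + s)" by (simp add: algebra_simps)
      ultimately show ?thesis
        using True t by (simp add: F_def powr_mult zero_less_mult_iff)
    next
      case False
      then show ?thesis using t by (simp add: F_def zero_less_mult_iff)
    qed
    have "integrable lborel (\<lambda>s. F t (0 + t * s))" unfolding scale using int by simp
    then have "integrable lborel (F t)" using t lborel_integrable_real_affine_iff[of t "F t" 0] by simp
    moreover have "integral\<^sup>L lborel (F t) = t * (t powr (q - 2) * c)"
      using lborel_integral_real_affine[of t "F t" 0] t unfolding scale c_def by simp
    moreover have "t * t powr (q - 2) = t powr (q - 1)"
      using t powr_add[of t 1 "q - 2"] by (simp add: algebra_simps)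
    ultimately show ?thesis by (simp add: has_bochner_integral_iff mult_ac)
  qed
  then show ?thesis using c unfolding F_def[abs_def] by blast
qed

section \<open>From resolvents to powers\<close>

text \<open>For these \<open>p\<close>, \<open>t powr p\<close> is a positive multiple of the
  integral of \<open>s powr p / (t + s)\<close> over \<open>s > 0\<close>, so the resolvent
  inequalities are integrated. At \<open>p = -1\<close> this integral diverges at zero, whence the
  open range.\<close>

lemma powr_sum_mono_of_resolvent:
  fixes a h :: "'x \<Rightarrow> real" and b m :: "'k \<Rightarrow> real"
  assumes p: "-1 < p" "p < 0"
    and h: "\<And>x. x \<in> X \<Longrightarrow> h x > 0" and m: "\<And>i. i \<in> I \<Longrightarrow> m i > 0"
    and le: "\<And>s. s > 0 \<Longrightarrow> (\<Sum>i\<in>I. b i / (m i + s)) \<le> (\<Sum>x\<in>X. a x / (h x + s))"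
  shows "(\<Sum>i\<in>I. b i * m i powr p) \<le> (\<Sum>x\<in>X. a x * h x powr p)"
proof -
  define F where "F t s = (if s > 0 then s powr p / (t + s) else 0)" for t s :: real
  have p1: "p + 1 - 1 = p" by simp
  obtain c where c: "c > 0"
    and F: "\<And>t. t > 0 \<Longrightarrow> has_bochner_integral lborel (F t) (c * t powr p)"
    using has_bochner_integral_Stieltjes_powr[of "p + 1", unfolded p1] p unfolding F_def[abs_def] by auto
  have "has_bochner_integral lborel (\<lambda>s. \<Sum>i\<in>I. b i * F (m i) s) (\<Sum>i\<in>I. b i * (c * m i powr p))"
    by (intro has_bochner_integral_sum has_bochner_integral_mult_right F m)
  moreover have "has_bochner_integral lborel (\<lambda>s. \<Sum>x\<in>X. a x * F (h x) s) (\<Sum>x\<in>X. a x * (c * h x powr p))"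
    by (intro has_bochner_integral_sum has_bochner_integral_mult_right F h)
  moreover have "(\<Sum>i\<in>I. b i * F (m i) s) \<le> (\<Sum>x\<in>X. a x * F (h x) s)" for s
    using mult_left_mono[OF le[of s], of "s powr p"]
    by (cases "s > 0") (simp_all add: F_def sum_distrib_left mult_ac)
  ultimately have "(\<Sum>i\<in>I. b i * (c * m i powr p)) \<le> (\<Sum>x\<in>X. a x * (c * h x powr p))"
    by (simp only: has_bochner_integral_iff) (metis (no_types, lifting) integral_mono)
  then have "c * (\<Sum>i\<in>I. b i * m i powr p) \<le> c * (\<Sum>x\<in>X. a x * h x powr p)"
    by (simp add: sum_distrib_left mult_ac)
  then show ?thesis using c by simp
qed

text \<open>Here the integrand is \<open>s powr (p - 1) * (t / (t + s))\<close>, and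
  \<open>t / (t + s) = 1 - s / (t + s)\<close>. The minus sign reverses the inequality; the constant
  terms cancel because the total weights agree.\<close>

lemma powr_sum_antimono_of_resolvent:
  fixes a h :: "'x \<Rightarrow> real" and b m :: "'k \<Rightarrow> real"
  assumes p: "0 < p" "p < 1"
    and h: "\<And>x. x \<in> X \<Longrightarrow> h x \<ge> 0" and m: "\<And>i. i \<in> I \<Longrightarrow> m i \<ge> 0"
    and eq: "sum a X = sum b I"
    and le: "\<And>s. s > 0 \<Longrightarrow> (\<Sum>i\<in>I. b i / (m i + s)) \<le> (\<Sum>x\<in>X. a x / (h x + s))"
  shows "(\<Sum>x\<in>X. a x * h x powr p) \<le> (\<Sum>i\<in>I. b i * m i powr p)"
proof -
  define F where "F t s = (if s > 0 then s powr (p - 1) / (t + s) else 0)" for t s :: real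
  obtain c where c: "c > 0" and F: "\<And>t. t > 0 \<Longrightarrow> has_bochner_integral lborel (F t) (c * t powr (p - 1))"
    using has_bochner_integral_Stieltjes_powr[of p] p unfolding F_def[abs_def] by auto
  \<comment> \<open>The factor \<open>t\<close> extends the formula to \<open>t = 0\<close>, where
    \<open>0 powr p = 0\<close>.\<close>
  have G: "has_bochner_integral lborel (\<lambda>s. t * F t s) (c * t powr p)" if "t \<ge> 0" for t
  proof (cases "t = 0")
    case False
    then have "t > 0" using that by simp
    have "t * (c * t powr (p - 1)) = c * t powr p"
      using \<open>t > 0\<close> powr_add[of t 1 "p - 1"] by simp
    with has_bochner_integral_mult_right[OF F[OF \<open>t > 0\<close>], of t] show ?thesis by simp
  qed (simp add: has_bochner_integral_zero)
  have "has_bochner_integral lborel (\<lambda>s. \<Sum>i\<in>I. b i * (m i * F (m i) s)) (\<Sum>i\<in>I. b i * (c * m i powr p))"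
    by (intro has_bochner_integral_sum has_bochner_integral_mult_right G m)
  moreover have "has_bochner_integral lborel (\<lambda>s. \<Sum>x\<in>X. a x * (h x * F (h x) s)) (\<Sum>x\<in>X. a x * (c * h x powr p))"
    by (intro has_bochner_integral_sum has_bochner_integral_mult_right G h)
  moreover have "(\<Sum>x\<in>X. a x * (h x * F (h x) s)) \<le> (\<Sum>i\<in>I. b i * (m i * F (m i) s))" for s
  proof (cases "s > 0")
    case s: True
    have split: "w * (t * F t s) = s powr (p - 1) * (w - s * (w / (t + s)))" if "t \<ge> 0" for t w
      using that s by (simp add: F_def field_simps)
    have "(\<Sum>x\<in>X. a x * (h x * F (h x) s)) = s powr (p - 1) * (sum a X - s * (\<Sum>x\<in>X. a x / (h x + s)))"
      unfolding sum_distrib_left sum_subtractf[symmetric]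
      by (intro sum.cong refl split h)
    also have "\<dots> \<le> s powr (p - 1) * (sum b I - s * (\<Sum>i\<in>I. b i / (m i + s)))"
      using s le[OF s] by (simp add: eq)
    also have "\<dots> = (\<Sum>i\<in>I. b i * (m i * F (m i) s))"
      unfolding sum_distrib_left sum_subtractf[symmetric]
      by (intro sum.cong refl split[symmetric] m)
    finally show ?thesis .
  qed (simp add: F_def)
  ultimately have "(\<Sum>x\<in>X. a x * (c * h x powr p)) \<le> (\<Sum>i\<in>I. b i * (c * m i powr p))"
    by (simp only: has_bochner_integral_iff) (metis (no_types, lifting) integral_mono)
  then have "c * (\<Sum>x\<in>X. a x * h x powr p) \<le> c * (\<Sum>i\<in>I. b i * m i powr p)"
    by (simp add: sum_distrib_left mult_ac)
  then show ?thesis using c by simp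
qed

text \<open>In the last conclusion both sides are the trace of \<open>\<sigma>\<close> against the
  combination. Strict positivity of the \<open>m i\<close> is recorded for the sake of negative
  powers.\<close>

lemma povm_combination_eigenbasis:
  fixes M :: "'x \<Rightarrow> complex^'n^'n"
  assumes M: "povm X M" and h: "\<And>x. x \<in> X \<Longrightarrow> h x \<ge> 0"
  obtains e :: "'n \<Rightarrow> complex^'n" and m where "orthonormal_on UNIV e" "\<And>i. m i \<ge> 0"
    "(\<And>x. x \<in> X \<Longrightarrow> h x > 0) \<Longrightarrow> (\<And>i. m i > 0)"
    "\<And>i. (\<Sum>x\<in>X. h x *\<^sub>R M x) *v e i = m i *\<^sub>R e i"
    "\<And>\<sigma>. (\<Sum>i\<in>UNIV. m i * meas_prob \<sigma> (\<lambda>i. outer (e i) (e i)) i) = (\<Sum>x\<in>X. h x * meas_prob \<sigma> M x)"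
proof -
  define H where "H = (\<Sum>x\<in>X. h x *\<^sub>R M x)"
  have psd: "psd (M x)" if "x \<in> X" for x using M that by (simp add: povm_def)
  then have "psd H" unfolding H_def using h by (rule psd_sum_scaleR)
  then obtain e :: "'n \<Rightarrow> complex^'n" and m where e: "orthonormal_on UNIV e"
    and eig: "\<And>i. H *v e i = m i *\<^sub>R e i" and m: "\<And>i. m i \<ge> 0"
    and H: "H = (\<Sum>i\<in>UNIV. m i *\<^sub>R outer (e i) (e i))"
    by (rule psd_orthonormal_eigenbasis) blast
  have mpos: "m i > 0" if pos: "\<And>x. x \<in> X \<Longrightarrow> h x > 0" for i
  proof -
    have ei: "cip (e i) (e i) = 1" using e by (simp add: orthonormal_on_def)
    have "m i = Re (qform H (e i))"
      by (simp add: qform_eq_cip eig cip_scaleR_right ei)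
    also have "\<dots> = (\<Sum>x\<in>X. h x * Re (qform (M x) (e i)))"
      by (simp add: H_def qform_eq_cip matrix_vector_mult_sum_left scaleR_matrix_vector_mult
          cip_sum_right cip_scaleR_right)
    finally have mi: "m i = (\<Sum>x\<in>X. h x * Re (qform (M x) (e i)))" .
    have "(\<Sum>x\<in>X. Re (qform (M x) (e i))) = Re (qform (\<Sum>x\<in>X. M x) (e i))"
      by (simp add: qform_eq_cip matrix_vector_mult_sum_left cip_sum_right)
    also have "\<dots> = 1" using M by (simp add: povm_def qform_eq_cip ei)
    finally have one: "(\<Sum>x\<in>X. Re (qform (M x) (e i))) = 1" .
    have nn: "Re (qform (M x) (e i)) \<ge> 0" if "x \<in> X" for x
      using psd[OF that] by (simp add: psd_def)
    \<comment> \<open>The weights of the outcomes at the unit vector \<open>e i\<close> sum to 1, so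
      one of them is nonzero.\<close>
    obtain x where x: "x \<in> X" "Re (qform (M x) (e i)) \<noteq> 0"
      using one sum.neutral[of X "\<lambda>x. Re (qform (M x) (e i))"] by fastforce
    show ?thesis unfolding mi
    proof (rule sum_pos2)
      show "finite X" using M by (simp add: povm_def)
      show "0 < h x * Re (qform (M x) (e i))"
        using x nn[OF x(1)] pos[OF x(1)] by simp
      show "0 \<le> h y * Re (qform (M y) (e i))" if "y \<in> X" for y
        using h[OF that] nn[OF that] by simp
    qed (rule x)
  qed
  have tr: "(\<Sum>i\<in>UNIV. m i * meas_prob \<sigma> (\<lambda>i. outer (e i) (e i)) i) = (\<Sum>x\<in>X. h x * meas_prob \<sigma> M x)" for \<sigma>
    by (simp only: trace_mult_sum_scaleR[symmetric] H_def[symmetric] H[symmetric])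
  show thesis by (rule that[OF e m mpos eig[unfolded H_def] tr])
qed

section \<open>Projective measurements versus POVMs\<close>

text \<open>In the geometric mean of \<open>r * u powr (1 - 1 / a)\<close> and \<open>u * s\<close>
  with weights \<open>a\<close> and \<open>1 - a\<close> the exponents of \<open>u\<close> cancel.
  The free \<open>u\<close> will be an eigenvalue \<open>m i\<close>.\<close>

lemma weighted_AM_GM_below_one:
  fixes r s u :: real
  assumes a: "0 < a" "a < 1" and r: "r \<ge> 0" and s: "s \<ge> 0" and u: "u > 0"
  shows "r powr a * s powr (1 - a) \<le> a * (r * u powr (1 - 1 / a)) + (1 - a) * (u * s)"
proof (cases "r = 0 \<or> s = 0")
  case True
  then show ?thesis using assms by auto
next
  case False
  then have rs: "r > 0" "s > 0" using r s by auto
  have "(r * u powr (1 - 1 / a)) powr a * (u * s) powr (1 - a)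
      = r powr a * s powr (1 - a) * (u powr ((1 - 1 / a) * a) * u powr (1 - a))"
    using rs u by (simp add: powr_mult powr_powr)
  also have "(1 - 1 / a) * a = a - 1" using a by (simp add: field_simps)
  also have "u powr (a - 1) * u powr (1 - a) = 1" using u by (simp flip: powr_add)
  finally show ?thesis
    using Youngs_inequality_0[of a "1 - a" "r * u powr (1 - 1 / a)" "u * s"] a rs u by simp
qed

text \<open>Now \<open>r * u powr (1 - 1 / a)\<close> is the geometric mean of the right side and
  \<open>u * s\<close>, with weights \<open>1 / a\<close> and \<open>1 - 1 / a\<close>; solving
  AM-GM for the right side gives the bound.\<close>

lemma weighted_AM_GM_above_one:
  fixes r s u :: real
  assumes a: "1 < a" and r: "r \<ge> 0" and s: "s > 0" and u: "u \<ge> 0"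
  shows "a * (r * u powr (1 - 1 / a)) + (1 - a) * (u * s) \<le> r powr a * s powr (1 - a)"
proof (cases "r = 0 \<or> u = 0")
  case True
  have "(1 - a) * (u * s) \<le> 0" using a u s by (intro mult_nonpos_nonneg) auto
  moreover have "a * (r * u powr (1 - 1 / a)) = 0" using True by auto
  moreover have "0 \<le> r powr a * s powr (1 - a)" by simp
  ultimately show ?thesis by linarith
next
  case False
  then have ru: "r > 0" "u > 0" using r u by auto
  define A where "A = r powr a * s powr (1 - a)"
  have "A powr (1 / a) * (u * s) powr (1 - 1 / a)
      = r powr (a * (1 / a)) * u powr (1 - 1 / a) * (s powr ((1 - a) * (1 / a)) * s powr (1 - 1 / a))"
    using ru s by (simp add: A_def powr_mult powr_powr)
  also have "a * (1 / a) = 1" using a by simp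
  also have "(1 - a) * (1 / a) = - (1 - 1 / a)" using a by (simp add: field_simps)
  also have "s powr - (1 - 1 / a) * s powr (1 - 1 / a) = 1" using s by (simp flip: powr_add)
  finally have "r * u powr (1 - 1 / a) = A powr (1 / a) * (u * s) powr (1 - 1 / a)"
    using ru by simp
  also have "\<dots> \<le> 1 / a * A + (1 - 1 / a) * (u * s)"
    using a ru s by (intro Youngs_inequality_0) (auto simp: A_def)
  finally have "a * (r * u powr (1 - 1 / a)) \<le> a * (1 / a * A + (1 - 1 / a) * (u * s))"
    using a by simp
  also have "\<dots> = A + (a - 1) * (u * s)" using a by (simp add: field_simps)
  finally show ?thesis unfolding A_def by (simp add: algebra_simps)
qed

text \<open>The convention at \<open>P x = 0\<close> is absorbed by
  \<open>0 powr \<alpha> = 0\<close>.\<close>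

lemma renyi_Q_below_one:
  assumes "\<alpha> < 1"
  shows "renyi_Q \<alpha> X P Q = ereal (\<Sum>x\<in>X. P x powr \<alpha> * Q x powr (1 - \<alpha>))"
  using assms by (auto simp: renyi_Q_def intro!: sum.cong)

section \<open>Comparing a POVM with an eigenbasis measurement\<close>

text \<open>This range of \<open>\<alpha>\<close> places \<open>p = 1 - 1 / \<alpha>\<close> in the
  interval from -1 (included) to 0 (excluded), where Jensen for powers follows from the
  resolvents.\<close>

lemma projective_improves_povm_above_half:
  fixes \<rho> \<sigma> :: "complex^'n^'n" and M :: "'x \<Rightarrow> complex^'n^'n"
  assumes \<alpha>: "1 / 2 \<le> \<alpha>" "\<alpha> < 1" and psd: "psd \<rho>" "psd \<sigma>" and M: "povm X M" and "\<epsilon> > 0"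
  shows "\<exists>P. proj_family P \<and>
    (\<Sum>i\<in>UNIV. meas_prob \<rho> P i powr \<alpha> * meas_prob \<sigma> P i powr (1 - \<alpha>))
      \<le> (\<Sum>x\<in>X. (meas_prob \<rho> M x + \<epsilon>) powr \<alpha> * (meas_prob \<sigma> M x + \<epsilon>) powr (1 - \<alpha>))"
proof -
  define p where "p = 1 - 1 / \<alpha>"
  define R where "R x = meas_prob \<rho> M x + \<epsilon>" for x
  define S where "S x = meas_prob \<sigma> M x + \<epsilon>" for x
  have RS: "R x > 0" "S x > 0" if "x \<in> X" for x
    using meas_prob_nonneg[OF psd(1), of M x] meas_prob_nonneg[OF psd(2), of M x] M that \<open>\<epsilon> > 0\<close>
    by (auto simp: R_def S_def povm_def)
  \<comment> \<open>Shifting both probabilities by \<epsilon> keeps h positive and finite when one of them vanishes.\<close>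
  define h where "h x = (R x / S x) powr \<alpha>" for x
  have h: "h x > 0" if "x \<in> X" for x using RS[OF that] by (simp add: h_def)
  then have "h x \<ge> 0" if "x \<in> X" for x using that by (simp add: less_imp_le)
  then obtain e :: "'n \<Rightarrow> complex^'n" and m where e: "orthonormal_on UNIV e"
    and m: "\<And>i. m i > 0"
    and eig: "\<And>i. (\<Sum>x\<in>X. h x *\<^sub>R M x) *v e i = m i *\<^sub>R e i"
    and tr: "\<And>\<sigma>. (\<Sum>i\<in>UNIV. m i * meas_prob \<sigma> (\<lambda>i. outer (e i) (e i)) i) = (\<Sum>x\<in>X. h x * meas_prob \<sigma> M x)"
    by (rule povm_combination_eigenbasis[OF M]) (use h in blast)+
  define P where "P i = outer (e i) (e i)" for i
  have nn: "meas_prob \<rho> P i \<ge> 0" "meas_prob \<sigma> P i \<ge> 0" for i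
    using psd by (auto intro!: meas_prob_nonneg simp: P_def psd_outer)
  have res: "(\<Sum>i\<in>UNIV. meas_prob \<rho> P i / (m i + s)) \<le> (\<Sum>x\<in>X. meas_prob \<rho> M x / (h x + s))"
    if "s \<ge> 0" for s
    using resolvent_Jensen_trace[OF psd(1) M _ e _ eig, of s] h m that
    by (simp add: P_def[abs_def] add_pos_nonneg)
  have Jensen: "(\<Sum>i\<in>UNIV. meas_prob \<rho> P i * m i powr p) \<le> (\<Sum>x\<in>X. meas_prob \<rho> M x * h x powr p)"
  proof (cases "\<alpha> = 1 / 2")
    case True
    \<comment> \<open>At this exponent the integral representation fails, but the claim is the
      resolvent inequality at \<open>s = 0\<close>.\<close>
    have p: "p = -1" unfolding p_def True by simp
    have pm: "y powr p = 1 / y" if "y > 0" for y using that by (simp add: p powr_minus_divide)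
    have "(\<Sum>x\<in>X. meas_prob \<rho> M x * h x powr p) = (\<Sum>x\<in>X. meas_prob \<rho> M x / h x)"
      by (intro sum.cong refl) (simp add: pm h)
    then show ?thesis using res[of 0] by (simp add: pm m)
  next
    case False
    then have "-1 < p" "p < 0" using \<alpha> by (auto simp: p_def field_simps)
    then show ?thesis by (rule powr_sum_mono_of_resolvent) (use h m res in auto)
  qed
  \<comment> \<open>Equality case of AM-GM: \<open>h\<close> is chosen so that
    \<open>R x * h x powr p\<close> and \<open>h x * S x\<close> coincide.\<close>
  have term_eq: "\<alpha> * (R x * h x powr p) + (1 - \<alpha>) * (h x * S x) = R x powr \<alpha> * S x powr (1 - \<alpha>)"
    if "x \<in> X" for x
  proof -
    have "\<alpha> * p = \<alpha> - 1" using \<alpha> by (simp add: p_def field_simps)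
    then have "h x powr p = (R x / S x) powr (\<alpha> - 1)" by (simp add: h_def powr_powr)
    then have 1: "R x * h x powr p = R x powr \<alpha> * S x powr (1 - \<alpha>)"
      using RS[OF that] by (simp add: powr_divide powr_diff)
    have 2: "h x * S x = R x powr \<alpha> * S x powr (1 - \<alpha>)"
      using RS[OF that] by (simp add: h_def powr_divide powr_diff)
    show ?thesis unfolding 1 2 by (simp add: algebra_simps)
  qed
  have "(\<Sum>i\<in>UNIV. meas_prob \<rho> P i powr \<alpha> * meas_prob \<sigma> P i powr (1 - \<alpha>))
      \<le> (\<Sum>i\<in>UNIV. \<alpha> * (meas_prob \<rho> P i * m i powr p) + (1 - \<alpha>) * (m i * meas_prob \<sigma> P i))"
    unfolding p_def using \<alpha> nn m by (intro sum_mono weighted_AM_GM_below_one) auto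
  also have "\<dots> \<le> \<alpha> * (\<Sum>x\<in>X. meas_prob \<rho> M x * h x powr p) + (1 - \<alpha>) * (\<Sum>x\<in>X. h x * meas_prob \<sigma> M x)"
    using Jensen \<alpha> tr[of \<sigma>] by (simp add: sum.distrib sum_distrib_left[symmetric] P_def[abs_def])
  also have "\<dots> = (\<Sum>x\<in>X. \<alpha> * (meas_prob \<rho> M x * h x powr p) + (1 - \<alpha>) * (h x * meas_prob \<sigma> M x))"
    by (simp add: sum.distrib sum_distrib_left)
  \<comment> \<open>The coefficients \<open>h x powr p\<close> and \<open>h x\<close> are
    nonnegative, so the shifted probabilities only increase the sum.\<close>
  also have "\<dots> \<le> (\<Sum>x\<in>X. \<alpha> * (R x * h x powr p) + (1 - \<alpha>) * (h x * S x))"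
    using \<alpha> \<open>\<epsilon> > 0\<close> h
    by (intro sum_mono add_mono mult_left_mono mult_right_mono) (auto simp: R_def S_def less_imp_le)
  also have "\<dots> = (\<Sum>x\<in>X. R x powr \<alpha> * S x powr (1 - \<alpha>))" by (intro sum.cong refl term_eq)
  finally show ?thesis
    using orthonormal_proj_family[OF e] unfolding R_def S_def P_def[abs_def] by blast
qed

text \<open>The sums are invariant under exchanging \<open>\<rho>\<close> with
  \<open>\<sigma>\<close> together with \<open>\<alpha>\<close> and \<open>1 - \<alpha>\<close>, and
  the previous bound asks only for positivity of both operators.\<close>

lemma projective_improves_povm_below_one:
  fixes \<rho> \<sigma> :: "complex^'n^'n" and M :: "'x \<Rightarrow> complex^'n^'n"
  assumes \<alpha>: "0 < \<alpha>" "\<alpha> < 1" and psd: "psd \<rho>" "psd \<sigma>" and M: "povm X M" and "\<epsilon> > 0"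
  shows "\<exists>P. proj_family P \<and>
    (\<Sum>i\<in>UNIV. meas_prob \<rho> P i powr \<alpha> * meas_prob \<sigma> P i powr (1 - \<alpha>))
      \<le> (\<Sum>x\<in>X. (meas_prob \<rho> M x + \<epsilon>) powr \<alpha> * (meas_prob \<sigma> M x + \<epsilon>) powr (1 - \<alpha>))"
proof (cases "\<alpha> \<ge> 1 / 2")
  case True
  then show ?thesis by (rule projective_improves_povm_above_half) (use assms in auto)
next
  case False
  then show ?thesis
    using projective_improves_povm_above_half[of "1 - \<alpha>" \<sigma> \<rho> X M \<epsilon>] assms by (simp add: mult.commute)
qed

text \<open>With \<open>p\<close> between 0 and 1 vanishing eigenvalues are harmless, so the POVM is
  compared unshifted. An infinite value is treated separately, through a single effect.\<close>

lemma projective_improves_povm_above_one: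
  fixes \<rho> \<sigma> :: "complex^'n^'n" and M :: "'x \<Rightarrow> complex^'n^'n"
  assumes \<alpha>: "1 < \<alpha>" and psd: "psd \<rho>" "psd \<sigma>" and M: "povm X M"
  shows "\<exists>P. proj_family P \<and> renyi_Q \<alpha> X (meas_prob \<rho> M) (meas_prob \<sigma> M)
    \<le> renyi_Q \<alpha> UNIV (meas_prob \<rho> P) (meas_prob \<sigma> P)"
proof (cases "\<exists>x\<in>X. meas_prob \<rho> M x > 0 \<and> meas_prob \<sigma> M x = 0")
  case True
  then obtain x where x: "x \<in> X" "meas_prob \<rho> M x > 0" "meas_prob \<sigma> M x = 0" by blast
  have "psd (M x)" using M x by (simp add: povm_def)
  \<comment> \<open>Measure in an eigenbasis of the offending effect \<open>M x\<close>. Its zero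
    expectation in \<open>\<sigma>\<close> is a sum of nonnegative terms, so each term vanishes,
    while some term of the expectation in \<open>\<rho>\<close> does not.\<close>
  then obtain e :: "'n \<Rightarrow> complex^'n" and m where e: "orthonormal_on UNIV e"
    and m: "\<And>i. m i \<ge> 0" and Mx: "M x = (\<Sum>i\<in>UNIV. m i *\<^sub>R outer (e i) (e i))"
    by (rule psd_orthonormal_eigenbasis) blast
  define P where "P i = outer (e i) (e i)" for i
  have nn: "meas_prob \<rho> P i \<ge> 0" "meas_prob \<sigma> P i \<ge> 0" for i
    using psd by (auto intro!: meas_prob_nonneg simp: P_def psd_outer)
  have tr: "meas_prob \<tau> M x = (\<Sum>i\<in>UNIV. m i * meas_prob \<tau> P i)" for \<tau>
    using trace_mult_sum_scaleR[of m P UNIV \<tau>] Mx by (simp add: meas_prob_def P_def)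
  obtain i where i: "m i * meas_prob \<rho> P i \<noteq> 0"
    using x(2) sum.neutral[of UNIV "\<lambda>i. m i * meas_prob \<rho> P i"] unfolding tr by fastforce
  have "m i * meas_prob \<sigma> P i = 0"
    using x(3) unfolding tr by (subst (asm) sum_nonneg_eq_0_iff) (auto simp: m nn)
  then have "meas_prob \<sigma> P i = 0" "meas_prob \<rho> P i > 0" using i nn[of i] by auto
  then have "renyi_Q \<alpha> UNIV (meas_prob \<rho> P) (meas_prob \<sigma> P) = \<infinity>"
    using \<alpha> by (auto simp: renyi_Q_def)
  then show ?thesis using orthonormal_proj_family[OF e] unfolding P_def[abs_def]
    by (intro exI conjI) auto
next
  case False
  define p where "p = 1 - 1 / \<alpha>"
  have p: "0 < p" "p < 1" using \<alpha> by (auto simp: p_def)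
  define R where "R = meas_prob \<rho> M"
  define S where "S = meas_prob \<sigma> M"
  have RS: "R x \<ge> 0" "S x \<ge> 0" if "x \<in> X" for x
    using M psd that by (auto simp: R_def S_def povm_def intro!: meas_prob_nonneg)
  have abs_cont: "R x = 0" if "x \<in> X" "S x = 0" for x
    using False RS[OF that(1)] that unfolding R_def S_def by force
  \<comment> \<open>If \<open>S x = 0\<close>, then \<open>R x = 0\<close> and
    \<open>h x = 0\<close>, as division by zero yields zero.\<close>
  define h where "h x = (R x / S x) powr \<alpha>" for x
  have h: "h x \<ge> 0" if "x \<in> X" for x by (simp add: h_def)
  obtain e :: "'n \<Rightarrow> complex^'n" and m where e: "orthonormal_on UNIV e"
    and m: "\<And>i. m i \<ge> 0"
    and eig: "\<And>i. (\<Sum>x\<in>X. h x *\<^sub>R M x) *v e i = m i *\<^sub>R e i"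
    and tr: "\<And>\<sigma>. (\<Sum>i\<in>UNIV. m i * meas_prob \<sigma> (\<lambda>i. outer (e i) (e i)) i) = (\<Sum>x\<in>X. h x * meas_prob \<sigma> M x)"
    by (rule povm_combination_eigenbasis[OF M h]) blast+
  define P where "P i = outer (e i) (e i)" for i
  have P: "proj_family P" using orthonormal_proj_family[OF e] by (simp add: P_def[abs_def])
  have nn: "meas_prob \<rho> P i \<ge> 0" "meas_prob \<sigma> P i \<ge> 0" for i
    using psd by (auto intro!: meas_prob_nonneg simp: P_def psd_outer)
  have Jensen: "(\<Sum>x\<in>X. R x * h x powr p) \<le> (\<Sum>i\<in>UNIV. meas_prob \<rho> P i * m i powr p)"
  proof (rule powr_sum_antimono_of_resolvent[OF p h m])
    \<comment> \<open>Both totals are the trace of \<open>\<rho>\<close>.\<close>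
    show "sum R X = sum (meas_prob \<rho> P) UNIV"
      using M proj_family_povm[OF P] by (simp add: povm_def R_def sum_meas_prob)
    show "(\<Sum>i\<in>UNIV. meas_prob \<rho> P i / (m i + s)) \<le> (\<Sum>x\<in>X. R x / (h x + s))" if "s > 0" for s
      using resolvent_Jensen_trace[OF psd(1) M _ e _ eig, of s] h m that
      by (simp add: P_def[abs_def] R_def add_nonneg_pos)
  qed
  have term_eq: "\<alpha> * (R x * h x powr p) + (1 - \<alpha>) * (h x * S x)
      = (if R x = 0 then 0 else R x powr \<alpha> * S x powr (1 - \<alpha>))" if "x \<in> X" for x
  proof (cases "R x = 0")
    case True
    then show ?thesis using \<alpha> by (simp add: h_def)
  next
    case False
    then have pos: "R x > 0" "S x > 0"
      using RS[OF that] abs_cont[OF that] by (auto simp: order_less_le)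
    have "\<alpha> * p = \<alpha> - 1" using \<alpha> by (simp add: p_def field_simps)
    then have "h x powr p = (R x / S x) powr (\<alpha> - 1)" by (simp add: h_def powr_powr)
    then have 1: "R x * h x powr p = R x powr \<alpha> * S x powr (1 - \<alpha>)"
      using pos by (simp add: powr_divide powr_diff)
    have 2: "h x * S x = R x powr \<alpha> * S x powr (1 - \<alpha>)"
      using pos by (simp add: h_def powr_divide powr_diff)
    show ?thesis unfolding 1 2 using False by (simp add: algebra_simps)
  qed
  have "renyi_Q \<alpha> X R S \<le> renyi_Q \<alpha> UNIV (meas_prob \<rho> P) (meas_prob \<sigma> P)"
  proof (cases "\<exists>i. meas_prob \<rho> P i > 0 \<and> meas_prob \<sigma> P i = 0")
    case True
    then show ?thesis using \<alpha> by (simp add: renyi_Q_def)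
  next
    case fin: False
    have "(\<Sum>x\<in>X. if R x = 0 then 0 else R x powr \<alpha> * S x powr (1 - \<alpha>))
        = \<alpha> * (\<Sum>x\<in>X. R x * h x powr p) + (1 - \<alpha>) * (\<Sum>x\<in>X. h x * S x)"
      by (simp add: sum_distrib_left sum.distrib[symmetric] term_eq)
    \<comment> \<open>The sums with the negative coefficient \<open>1 - \<alpha>\<close> are equal
      by \<open>tr\<close>; the inequality is Jensen alone.\<close>
    also have "\<dots> \<le> \<alpha> * (\<Sum>i\<in>UNIV. meas_prob \<rho> P i * m i powr p) + (1 - \<alpha>) * (\<Sum>i\<in>UNIV. m i * meas_prob \<sigma> P i)"
      using Jensen \<alpha> tr[of \<sigma>] by (simp add: P_def[abs_def] S_def)
    also have "\<dots> = (\<Sum>i\<in>UNIV. \<alpha> * (meas_prob \<rho> P i * m i powr p) + (1 - \<alpha>) * (m i * meas_prob \<sigma> P i))"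
      by (simp add: sum_distrib_left sum.distrib)
    also have "\<dots> \<le> (\<Sum>i\<in>UNIV. if meas_prob \<rho> P i = 0 then 0
        else meas_prob \<rho> P i powr \<alpha> * meas_prob \<sigma> P i powr (1 - \<alpha>))"
    proof (rule sum_mono)
      fix i
      show "\<alpha> * (meas_prob \<rho> P i * m i powr p) + (1 - \<alpha>) * (m i * meas_prob \<sigma> P i)
        \<le> (if meas_prob \<rho> P i = 0 then 0 else meas_prob \<rho> P i powr \<alpha> * meas_prob \<sigma> P i powr (1 - \<alpha>))"
      proof (cases "meas_prob \<rho> P i = 0")
        case True
        have "(1 - \<alpha>) * (m i * meas_prob \<sigma> P i) \<le> 0"
          using \<alpha> m nn by (intro mult_nonpos_nonneg) auto
        then show ?thesis using True by simp
      next
        case nz: False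
        then have "meas_prob \<sigma> P i > 0" using nn[of i] fin by (auto simp: order_less_le)
        then show ?thesis using weighted_AM_GM_above_one[OF \<alpha> nn(1) _ m] nz by (simp add: p_def)
      qed
    qed
    finally show ?thesis using False[folded R_def S_def] fin by (simp add: renyi_Q_def)
  qed
  then show ?thesis using P unfolding R_def S_def by blast
qed

section \<open>From Renyi quantities to divergences\<close>

text \<open>The divergence increases with \<open>q\<close>. Positivity excludes
  \<open>q = 0\<close>, where \<open>D_of_Q\<close> is computed from the default value
  \<open>ln 0\<close> instead of being minus infinity.\<close>

lemma D_of_Q_le_iff_above_one:
  assumes "\<alpha> > 1" "q > 0"
  shows "D_of_Q \<alpha> q \<le> ereal s \<longleftrightarrow> q \<le> ereal (exp ((\<alpha> - 1) * s))"
proof (cases q)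
  case (real r)
  then have "r > 0" using assms by simp
  then have "ln r / (\<alpha> - 1) \<le> s \<longleftrightarrow> r \<le> exp ((\<alpha> - 1) * s)"
    using assms by (simp add: pos_divide_le_eq mult.commute) (metis exp_gt_zero exp_le_cancel_iff exp_ln)
  then show ?thesis using real assms by (simp add: D_of_Q_def)
qed (use assms in \<open>auto simp: D_of_Q_def\<close>)

text \<open>The divergence decreases with \<open>q\<close> because \<open>\<alpha> - 1\<close> is
  negative. At \<open>q = 0\<close> both sides are false: the divergence is infinite and the
  exponential is positive.\<close>

lemma D_of_Q_le_iff_below_one:
  assumes "\<alpha> < 1" "q \<ge> 0" "q \<noteq> \<infinity>"
  shows "D_of_Q \<alpha> q \<le> ereal s \<longleftrightarrow> ereal (exp ((\<alpha> - 1) * s)) \<le> q"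
proof (cases q)
  case (real r)
  show ?thesis
  proof (cases "r = 0")
    case True
    then show ?thesis using real assms by (simp add: D_of_Q_def zero_ereal_def)
  next
    case False
    then have "r > 0" using assms real by simp
    then have "ln r / (\<alpha> - 1) \<le> s \<longleftrightarrow> exp ((\<alpha> - 1) * s) \<le> r"
      using assms by (simp add: neg_divide_le_eq ln_ge_iff mult.commute)
    then show ?thesis using real assms False by (simp add: D_of_Q_def)
  qed
qed (use assms in auto)

text \<open>Projective families are indexed by \<open>'n\<close>, whereas
  \<open>measured_renyi\<close> ranges over outcome sets of natural numbers.\<close>

lemma proj_family_relabel:
  fixes P :: "'n \<Rightarrow> complex^'n^'n"
  assumes "proj_family P"
  obtains X :: "nat set" and M where "povm X M"
    "\<And>\<rho> \<sigma>. renyi_Q \<alpha> X (meas_prob \<rho> M) (meas_prob \<sigma> M) = renyi_Q \<alpha> UNIV (meas_prob \<rho> P) (meas_prob \<sigma> P)"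
proof -
  obtain f :: "'n \<Rightarrow> nat" where "bij_betw f UNIV {0..<CARD('n)}"
    using ex_bij_betw_finite_nat[of "UNIV :: 'n set"] by auto
  then have f: "inj f" "range f = {0..<CARD('n)}" by (auto simp: bij_betw_def)
  define M where "M = P \<circ> inv f"
  have Mf: "M (f i) = P i" "meas_prob \<tau> M (f i) = meas_prob \<tau> P i" for i \<tau>
    using f(1) by (simp_all add: M_def meas_prob_def)
  have sum: "sum g (range f) = (\<Sum>i\<in>UNIV. g (f i))" for g :: "nat \<Rightarrow> 'z::comm_monoid_add"
    using sum.reindex[OF f(1), of g] by simp
  have "povm (range f) M"
    using proj_family_povm[OF assms] by (simp add: povm_def sum Mf)
  moreover have "renyi_Q \<alpha> (range f) (meas_prob \<rho> M) (meas_prob \<sigma> M)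
      = renyi_Q \<alpha> UNIV (meas_prob \<rho> P) (meas_prob \<sigma> P)" for \<rho> \<sigma>
    by (simp add: renyi_Q_def sum Mf cong: if_cong)
  ultimately show thesis using that by blast
qed

text \<open>The standard basis. Having at least one family makes the supremum of the quantities
  positive and their infimum finite.\<close>

lemma proj_family_exists: "\<exists>P :: 'n \<Rightarrow> complex^'n^'n. proj_family P"
proof -
  have "orthonormal_on UNIV (\<lambda>i::'n. axis i (1::complex))"
    by (simp add: orthonormal_on_def cip_def axis_def if_distrib[of cnj] if_distrib[of "\<lambda>z. z * _"]
        cong: if_cong)
  then show ?thesis using orthonormal_proj_family by blast
qed

text \<open>The normalisation of \<open>\<rho>\<close> enters here: some outcome has positive
  probability, and it contributes a positive or infinite term.\<close>

lemma renyi_Q_pos: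
  assumes \<rho>: "density_op \<rho>" and \<sigma>: "psd \<sigma>" and M: "povm X M" and \<alpha>: "\<alpha> > 1"
  shows "renyi_Q \<alpha> X (meas_prob \<rho> M) (meas_prob \<sigma> M) > 0"
proof (cases "\<exists>x\<in>X. meas_prob \<rho> M x > 0 \<and> meas_prob \<sigma> M x = 0")
  case True
  then show ?thesis using \<alpha> by (auto simp: renyi_Q_def)
next
  case False
  have nn: "meas_prob \<rho> M x \<ge> 0" "meas_prob \<sigma> M x \<ge> 0" if "x \<in> X" for x
    using assms that by (auto simp: povm_def density_op_def intro!: meas_prob_nonneg)
  have "(\<Sum>x\<in>X. meas_prob \<rho> M x) = 1"
    using M \<rho> by (simp add: povm_def density_op_def sum_meas_prob)
  then obtain x where x: "x \<in> X" "meas_prob \<rho> M x \<noteq> 0"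
    using sum.neutral[of X "meas_prob \<rho> M"] by fastforce
  then have pos: "meas_prob \<rho> M x > 0" "meas_prob \<sigma> M x > 0"
    using nn[OF x(1)] False by (auto simp: order_less_le)
  have "0 < (\<Sum>x\<in>X. if meas_prob \<rho> M x = 0 then 0
      else meas_prob \<rho> M x powr \<alpha> * meas_prob \<sigma> M x powr (1 - \<alpha>))"
    by (rule sum_pos2[OF _ x(1)]) (use M pos in \<open>auto simp: povm_def\<close>)
  then show ?thesis using False by (auto simp: renyi_Q_def)
qed

text \<open>The shift is removed by letting it tend to zero. The improving family depends on the
  shift, so the conclusion is phrased through a common lower bound \<open>c\<close> of all
  families.\<close>

lemma renyi_Q_ge_of_projective_below_one:
  fixes \<rho> \<sigma> :: "complex^'n^'n" and M :: "'x \<Rightarrow> complex^'n^'n"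
  assumes \<alpha>: "0 < \<alpha>" "\<alpha> < 1" and psd: "psd \<rho>" "psd \<sigma>" and M: "povm X M"
    and bound: "\<And>P. proj_family P \<Longrightarrow> c \<le> renyi_Q \<alpha> UNIV (meas_prob \<rho> P) (meas_prob \<sigma> P)"
  shows "c \<le> renyi_Q \<alpha> X (meas_prob \<rho> M) (meas_prob \<sigma> M)"
proof -
  define F where "F \<epsilon> = (\<Sum>x\<in>X. (meas_prob \<rho> M x + \<epsilon>) powr \<alpha> * (meas_prob \<sigma> M x + \<epsilon>) powr (1 - \<alpha>))" for \<epsilon>
  have nn: "meas_prob \<rho> M x \<ge> 0" "meas_prob \<sigma> M x \<ge> 0" if "x \<in> X" for x
    using M psd that by (auto simp: povm_def intro!: meas_prob_nonneg)
  have "c \<le> ereal (F \<epsilon>)" if \<epsilon>: "\<epsilon> > 0" for \<epsilon>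
  proof -
    obtain P where P: "proj_family P"
      "(\<Sum>i\<in>UNIV. meas_prob \<rho> P i powr \<alpha> * meas_prob \<sigma> P i powr (1 - \<alpha>)) \<le> F \<epsilon>"
      using projective_improves_povm_below_one[OF \<alpha> psd M \<epsilon>] unfolding F_def by blast
    then have "c \<le> ereal (\<Sum>i\<in>UNIV. meas_prob \<rho> P i powr \<alpha> * meas_prob \<sigma> P i powr (1 - \<alpha>))"
      using bound renyi_Q_below_one[OF \<alpha>(2)] by metis
    also have "\<dots> \<le> ereal (F \<epsilon>)" using P by simp
    finally show ?thesis .
  qed
  \<comment> \<open>Continuity holds even where a probability vanishes, since both exponents are
    positive and the bases stay nonnegative to the right of zero.\<close>
  moreover have "(F \<longlongrightarrow> F 0) (at_right 0)"
    unfolding F_def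
  proof (intro tendsto_sum tendsto_mult tendsto_powr2 tendsto_intros tendsto_ident_at)
  qed (use \<alpha> nn in \<open>auto simp: eventually_at_filter\<close>)
  ultimately have "c \<le> ereal (F 0)"
    by (intro tendsto_lowerbound[of "\<lambda>\<epsilon>. ereal (F \<epsilon>)" _ "at_right 0"])
      (auto simp: eventually_at_filter)
  then show ?thesis by (simp add: renyi_Q_below_one[OF \<alpha>(2)] F_def)
qed

theorem theorem4:
  fixes \<rho> \<sigma> :: "complex^'n^'n" and \<alpha> :: real
  assumes "density_op \<rho>" and "psd \<sigma>"
    and "\<alpha> \<in> {0<..<1} \<union> {1<..}"
  shows "proj_renyi \<alpha> \<rho> \<sigma> = measured_renyi \<alpha> \<rho> \<sigma>"
proof -
  have psd: "psd \<rho>" "psd \<sigma>" using assms by (auto simp: density_op_def)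
  define QP where "QP P = renyi_Q \<alpha> UNIV (meas_prob \<rho> P) (meas_prob \<sigma> P)" for P :: "'n \<Rightarrow> complex^'n^'n"
  define QM where "QM XM = renyi_Q \<alpha> (fst XM) (meas_prob \<rho> (snd XM)) (meas_prob \<sigma> (snd XM))"
    for XM :: "nat set \<times> (nat \<Rightarrow> complex^'n^'n)"
  define \<P> where "\<P> = {P :: 'n \<Rightarrow> complex^'n^'n. proj_family P}"
  define \<M> where "\<M> = {(X :: nat set, M :: nat \<Rightarrow> complex^'n^'n). povm X M}"
  have meas: "measured_renyi \<alpha> \<rho> \<sigma> \<le> ereal s \<longleftrightarrow> (\<forall>XM\<in>\<M>. D_of_Q \<alpha> (QM XM) \<le> ereal s)" for s
    by (simp add: measured_renyi_def SUP_le_iff renyi_div_def QM_def \<M>_def)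
  obtain P0 where P0: "P0 \<in> \<P>" using proj_family_exists by (auto simp: \<P>_def)
  have relabel: "\<exists>XM\<in>\<M>. QM XM = QP P" if "P \<in> \<P>" for P
  proof -
    have "proj_family P" using that by (simp add: \<P>_def)
    then obtain X :: "nat set" and M where "povm X M"
      "\<And>\<rho> \<sigma>. renyi_Q \<alpha> X (meas_prob \<rho> M) (meas_prob \<sigma> M) = renyi_Q \<alpha> UNIV (meas_prob \<rho> P) (meas_prob \<sigma> P)"
      by (rule proj_family_relabel) blast
    then show ?thesis by (intro bexI[of _ "(X, M)"]) (auto simp: QM_def QP_def \<M>_def)
  qed
  \<comment> \<open>Extended reals with the same real upper bounds coincide, so it is enough to
    compare these bounds.\<close>
  have "proj_renyi \<alpha> \<rho> \<sigma> \<le> ereal s \<longleftrightarrow> measured_renyi \<alpha> \<rho> \<sigma> \<le> ereal s" for s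
  proof (cases "\<alpha> > 1")
    case True
    define E where "E = ereal (exp ((\<alpha> - 1) * s))"
    have posM: "QM XM > 0" if "XM \<in> \<M>" for XM
      using that renyi_Q_pos[OF assms(1,2) _ True] by (auto simp: \<M>_def QM_def)
    from relabel[OF P0] obtain XM where "XM \<in> \<M>" "QM XM = QP P0" ..
    then have "0 < QP P0" using posM[of XM] by simp
    also have "\<dots> \<le> (SUP P\<in>\<P>. QP P)" using P0 by (rule SUP_upper)
    finally have "proj_renyi \<alpha> \<rho> \<sigma> \<le> ereal s \<longleftrightarrow> (SUP P\<in>\<P>. QP P) \<le> E"
      using True by (simp add: proj_renyi_def proj_Q_def \<P>_def QP_def E_def D_of_Q_le_iff_above_one)
    also have "\<dots> \<longleftrightarrow> (\<forall>P\<in>\<P>. QP P \<le> E)" by (rule SUP_le_iff)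
    also have "\<dots> \<longleftrightarrow> (\<forall>XM\<in>\<M>. QM XM \<le> E)"
    proof
      assume L: "\<forall>P\<in>\<P>. QP P \<le> E"
      show "\<forall>XM\<in>\<M>. QM XM \<le> E"
      proof
        fix XM assume "XM \<in> \<M>"
        then obtain P where "P \<in> \<P>" "QM XM \<le> QP P"
          using projective_improves_povm_above_one[OF True psd, of "fst XM" "snd XM"]
          by (auto simp: \<M>_def \<P>_def QM_def QP_def)
        then show "QM XM \<le> E" using L by force
      qed
    next
      assume R: "\<forall>XM\<in>\<M>. QM XM \<le> E"
      show "\<forall>P\<in>\<P>. QP P \<le> E"
      proof
        fix P assume "P \<in> \<P>"
        from relabel[OF this] obtain XM where "XM \<in> \<M>" "QM XM = QP P" ..
        with R show "QP P \<le> E" by metis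
      qed
    qed
    also have "\<dots> \<longleftrightarrow> measured_renyi \<alpha> \<rho> \<sigma> \<le> ereal s"
      using True posM by (simp add: meas E_def D_of_Q_le_iff_above_one)
    finally show ?thesis .
  next
    case False
    then have \<alpha>: "0 < \<alpha>" "\<alpha> < 1" using assms(3) by auto
    define E where "E = ereal (exp ((\<alpha> - 1) * s))"
    have fin: "0 \<le> QP P" "QP P \<noteq> \<infinity>" "0 \<le> QM XM" "QM XM \<noteq> \<infinity>" for P XM
      by (simp_all add: QP_def QM_def renyi_Q_below_one[OF \<alpha>(2)] sum_nonneg)
    have "0 \<le> (INF P\<in>\<P>. QP P)" using fin by (intro INF_greatest)
    moreover have "(INF P\<in>\<P>. QP P) \<le> QP P0" using P0 by (rule INF_lower)
    then have "(INF P\<in>\<P>. QP P) \<noteq> \<infinity>" using fin by auto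
    \<comment> \<open>An upper bound on the divergence is a lower bound on the quantity, so the
      infimum over families matches the supremum of divergences.\<close>
    ultimately have "proj_renyi \<alpha> \<rho> \<sigma> \<le> ereal s \<longleftrightarrow> E \<le> (INF P\<in>\<P>. QP P)"
      using \<alpha> by (simp add: proj_renyi_def proj_Q_def \<P>_def QP_def E_def D_of_Q_le_iff_below_one)
    also have "\<dots> \<longleftrightarrow> (\<forall>P\<in>\<P>. E \<le> QP P)" by (rule le_INF_iff)
    also have "\<dots> \<longleftrightarrow> (\<forall>XM\<in>\<M>. E \<le> QM XM)"
    proof
      assume L: "\<forall>P\<in>\<P>. E \<le> QP P"
      show "\<forall>XM\<in>\<M>. E \<le> QM XM"
      proof
        fix XM assume "XM \<in> \<M>"
        then have "povm (fst XM) (snd XM)" by (auto simp: \<M>_def)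
        then show "E \<le> QM XM"
          unfolding QM_def
          by (rule renyi_Q_ge_of_projective_below_one[OF \<alpha> psd])
            (use L in \<open>simp add: \<P>_def QP_def\<close>)
      qed
    next
      assume R: "\<forall>XM\<in>\<M>. E \<le> QM XM"
      show "\<forall>P\<in>\<P>. E \<le> QP P"
      proof
        fix P assume "P \<in> \<P>"
        from relabel[OF this] obtain XM where "XM \<in> \<M>" "QM XM = QP P" ..
        with R show "E \<le> QP P" by metis
      qed
    qed
    also have "\<dots> \<longleftrightarrow> measured_renyi \<alpha> \<rho> \<sigma> \<le> ereal s"
      using \<alpha> fin by (simp add: meas E_def D_of_Q_le_iff_below_one)
    finally show ?thesis .
  qed
  then show ?thesis by (metis ereal_le_real order_antisym)
qed

end
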